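(* The budgeted MBC problem can be solved exactly in polynomial time when the input graph $G$ is a tree.
   Context: An instance of budgeted \textsc{Maximum Betweenness Centrality} (MBC) consists of an undirected connected graph $G=(V,E)$, node costs $c\colon V\to\mathbb{R}_{\ge 0}$ and a budget $b\ge 0$. For distinct $s,t\in V$ let $\sigma_{s,t}$ be the number of shortest $s$--$t$ paths, and for $C\subseteq V$ let $\sigma_{s,t}(C)$ be the number of shortest $s$--$t$ paths containing at least one node of $C$. The group betweenness centrality is $\operatorname{GBC}(C)=\sum_{s,t\in V,\ s\neq t}\sigma_{s,t}(C)/\sigma_{s,t}$. The goal is to find $C\subseteq V$ with $\sum_{v\in C}c(v)\le b$ maximizing $\operatorname{GBC}(C)$. *)

theory Defs
  imports Complex_Main "HOL-Computational_Algebra.Polynomial"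
begin

section \<open>Undirected graphs\<close>

definition ugraph :: "'v set \<Rightarrow> 'v set set \<Rightarrow> bool" where
  "ugraph V E \<longleftrightarrow> finite V \<and> (\<forall>e\<in>E. \<exists>u\<in>V. \<exists>v\<in>V. u \<noteq> v \<and> e = {u, v})"

definition is_path :: "'v set \<Rightarrow> 'v set set \<Rightarrow> 'v list \<Rightarrow> bool" where
  "is_path V E xs \<longleftrightarrow> xs \<noteq> [] \<and> set xs \<subseteq> V \<and> distinct xs \<and>
     (\<forall>i. Suc i < length xs \<longrightarrow> {xs ! i, xs ! Suc i} \<in> E)"

definition st_paths :: "'v set \<Rightarrow> 'v set set \<Rightarrow> 'v \<Rightarrow> 'v \<Rightarrow> 'v list set" where
  "st_paths V E s t = {xs. is_path V E xs \<and> hd xs = s \<and> last xs = t}"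

definition connected_graph :: "'v set \<Rightarrow> 'v set set \<Rightarrow> bool" where
  "connected_graph V E \<longleftrightarrow> V \<noteq> {} \<and> (\<forall>s\<in>V. \<forall>t\<in>V. st_paths V E s t \<noteq> {})"

definition is_cycle :: "'v set \<Rightarrow> 'v set set \<Rightarrow> 'v list \<Rightarrow> bool" where
  "is_cycle V E xs \<longleftrightarrow> is_path V E xs \<and> 3 \<le> length xs \<and> {last xs, hd xs} \<in> E"

definition is_tree :: "'v set \<Rightarrow> 'v set set \<Rightarrow> bool" where
  "is_tree V E \<longleftrightarrow> ugraph V E \<and> connected_graph V E \<and> (\<nexists>xs. is_cycle V E xs)"


section \<open>Group betweenness centrality\<close>

definition shortest_paths :: "'v set \<Rightarrow> 'v set set \<Rightarrow> 'v \<Rightarrow> 'v \<Rightarrow> 'v list set" where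
  "shortest_paths V E s t =
     {xs \<in> st_paths V E s t. \<forall>ys \<in> st_paths V E s t. length xs \<le> length ys}"

definition num_sp :: "'v set \<Rightarrow> 'v set set \<Rightarrow> 'v \<Rightarrow> 'v \<Rightarrow> nat" where
  "num_sp V E s t = card (shortest_paths V E s t)"

text \<open>The end nodes of a path count as nodes of the path.\<close>

definition num_sp_via :: "'v set \<Rightarrow> 'v set set \<Rightarrow> 'v \<Rightarrow> 'v \<Rightarrow> 'v set \<Rightarrow> nat" where
  "num_sp_via V E s t C = card {xs \<in> shortest_paths V E s t. set xs \<inter> C \<noteq> {}}"

definition GBC :: "'v set \<Rightarrow> 'v set set \<Rightarrow> 'v set \<Rightarrow> real" where
  "GBC V E C =
     (\<Sum>(s, t) \<in> {(s, t). s \<in> V \<and> t \<in> V \<and> s \<noteq> t}.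
        real (num_sp_via V E s t C) / real (num_sp V E s t))"


section \<open>Budgeted maximum betweenness centrality\<close>

record 'v mbc =
  nodes :: "'v set"
  edges :: "'v set set"
  cost :: "'v \<Rightarrow> real"
  budget :: real

definition mbc_instance :: "'v mbc \<Rightarrow> bool" where
  "mbc_instance I \<longleftrightarrow> ugraph (nodes I) (edges I) \<and> connected_graph (nodes I) (edges I) \<and>
     (\<forall>v \<in> nodes I. 0 \<le> cost I v) \<and> 0 \<le> budget I"

definition mbc_feasible :: "'v mbc \<Rightarrow> 'v set \<Rightarrow> bool" where
  "mbc_feasible I C \<longleftrightarrow> C \<subseteq> nodes I \<and> (\<Sum>v\<in>C. cost I v) \<le> budget I"

definition mbc_optimal :: "'v mbc \<Rightarrow> 'v set \<Rightarrow> bool" where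
  "mbc_optimal I C \<longleftrightarrow> mbc_feasible I C \<and>
     (\<forall>D. mbc_feasible I D \<longrightarrow>
        GBC (nodes I) (edges I) D \<le> GBC (nodes I) (edges I) C)"


section \<open>A unit-cost random access machine over the naturals and the reals\<close>

text \<open>
  Costs and budget are arbitrary real numbers, so the machine has a memory of naturals and a
  memory of reals. Each memory is divided into named arrays; a program mentions only finitely
  many names. The only arithmetic operations are addition and subtraction (truncated on the
  naturals), and the only test is comparison. There is deliberately no multiplication and no
  rounding, and the real constants are rational. Hence after \<open>t\<close> steps every natural has
  \<open>O(t + l)\<close> bits, where \<open>l\<close> is the largest bit length of a natural in the input, and on rational
  inputs every real in memory is likewise a rational with \<open>O(t + l)\<close> bits once all rationals are
  written with one common denominator (\<open>l\<close> then also bounding the input rationals so written).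
  Unit cost thus hides no computational power: polynomially many steps on rational inputs take
  polynomial time on a Turing machine.
\<close>

type_synonym vname = string

datatype nexp =
    NConst nat
  | NGet vname nexp
  | NAdd nexp nexp
  | NSub nexp nexp

datatype rexp =
    RConst rat
  | RGet vname nexp
  | RAdd rexp rexp
  | RSub rexp rexp

datatype bexp =
    NLess nexp nexp
  | RLess rexp rexp
  | BNot bexp
  | BAnd bexp bexp

text \<open>\<open>NSet x i e\<close> stores the value of \<open>e\<close> in cell \<open>i\<close> of the array \<open>x\<close>.\<close>

datatype com =
    Skip
  | NSet vname nexp nexp
  | RSet vname nexp rexp
  | Seq com com
  | Cond bexp com com
  | While bexp com

record store =
  nmem :: "vname \<Rightarrow> nat \<Rightarrow> nat"
  rmem :: "vname \<Rightarrow> nat \<Rightarrow> real"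

primrec nval :: "nexp \<Rightarrow> store \<Rightarrow> nat" where
  "nval (NConst k) s = k"
| "nval (NGet x i) s = nmem s x (nval i s)"
| "nval (NAdd a b) s = nval a s + nval b s"
| "nval (NSub a b) s = nval a s - nval b s"

primrec rval :: "rexp \<Rightarrow> store \<Rightarrow> real" where
  "rval (RConst q) s = of_rat q"
| "rval (RGet x i) s = rmem s x (nval i s)"
| "rval (RAdd a b) s = rval a s + rval b s"
| "rval (RSub a b) s = rval a s - rval b s"

primrec bval :: "bexp \<Rightarrow> store \<Rightarrow> bool" where
  "bval (NLess a b) s \<longleftrightarrow> nval a s < nval b s"
| "bval (RLess a b) s \<longleftrightarrow> rval a s < rval b s"
| "bval (BNot p) s \<longleftrightarrow> \<not> bval p s"
| "bval (BAnd p q) s \<longleftrightarrow> bval p s \<and> bval q s"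

definition nupd :: "vname \<Rightarrow> nat \<Rightarrow> nat \<Rightarrow> store \<Rightarrow> store" where
  "nupd x i k s = s\<lparr>nmem := (nmem s)(x := (nmem s x)(i := k))\<rparr>"

definition rupd :: "vname \<Rightarrow> nat \<Rightarrow> real \<Rightarrow> store \<Rightarrow> store" where
  "rupd x i r s = s\<lparr>rmem := (rmem s)(x := (rmem s x)(i := r))\<rparr>"

text \<open>
  \<open>exec P s t s'\<close>: started in \<open>s\<close>, the program \<open>P\<close> halts in \<open>s'\<close> after \<open>t\<close> steps. Assignments and
  tests take one step each; the expressions in a fixed program have bounded size.
\<close>

inductive exec :: "com \<Rightarrow> store \<Rightarrow> nat \<Rightarrow> store \<Rightarrow> bool" where
  Skip: "exec Skip s 1 s"
| NSet: "exec (NSet x i e) s 1 (nupd x (nval i s) (nval e s) s)"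
| RSet: "exec (RSet x i e) s 1 (rupd x (nval i s) (rval e s) s)"
| Seq: "exec P s t s' \<Longrightarrow> exec Q s' t' s'' \<Longrightarrow> exec (Seq P Q) s (t + t') s''"
| CondTrue: "bval p s \<Longrightarrow> exec P s t s' \<Longrightarrow> exec (Cond p P Q) s (Suc t) s'"
| CondFalse: "\<not> bval p s \<Longrightarrow> exec Q s t s' \<Longrightarrow> exec (Cond p P Q) s (Suc t) s'"
| WhileFalse: "\<not> bval p s \<Longrightarrow> exec (While p P) s 1 s"
| WhileTrue: "bval p s \<Longrightarrow> exec P s t s' \<Longrightarrow> exec (While p P) s' t' s'' \<Longrightarrow>
    exec (While p P) s (Suc (t + t')) s''"

inductive_cases exec_SkipE: "exec Skip s t s'"
  and exec_NSetE: "exec (NSet x i e) s t s'"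
  and exec_RSetE: "exec (RSet x i e) s t s'"
  and exec_SeqE: "exec (Seq P Q) s t s'"
  and exec_CondE: "exec (Cond p P Q) s t s'"
  and exec_WhileE: "exec (While p P) s t s'"

lemma exec_deterministic:
  "exec P s t s' \<Longrightarrow> exec P s u s'' \<Longrightarrow> u = t \<and> s'' = s'"
proof (induction arbitrary: u s'' rule: exec.induct)
  case (Seq P s t s' Q t' r)
  from Seq.prems show ?case by (rule exec_SeqE) (use Seq.IH in blast)
next
  case (CondTrue p s P t s' Q)
  from CondTrue.prems show ?case by (rule exec_CondE) (use CondTrue in blast)+
next
  case (CondFalse p s Q t s' P)
  from CondFalse.prems show ?case by (rule exec_CondE) (use CondFalse in blast)+
next
  case (WhileTrue p s P t s' t' r)
  from WhileTrue.prems show ?case by (rule exec_WhileE) (use WhileTrue in blast)+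
qed (auto elim: exec_SkipE exec_NSetE exec_RSetE exec_WhileE)

text \<open>
  One program and one polynomial serve all instances: \<open>enc x\<close> is the initial store for the
  instance \<open>x\<close>, and \<open>correct x s'\<close> says that the final store \<open>s'\<close> holds a correct answer for \<open>x\<close>.
\<close>

definition polytime_solvable ::
    "'i set \<Rightarrow> ('i \<Rightarrow> nat) \<Rightarrow> ('i \<Rightarrow> store) \<Rightarrow> ('i \<Rightarrow> store \<Rightarrow> bool) \<Rightarrow> bool" where
  "polytime_solvable X size_of enc correct \<longleftrightarrow>
     (\<exists>(P :: com) (p :: nat poly). \<forall>x\<in>X. \<exists>t s'.
        exec P (enc x) t s' \<and> t \<le> poly p (size_of x) \<and> correct x s')"


section \<open>Instances as machine input\<close>

text \<open>
  As machine input, a graph on \<open>n\<close> nodes has its nodes numbered \<open>0, \<dots>, n - 1\<close>. It is given by \<open>n\<close>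
  and its adjacency matrix, stored row by row; costs and budget are given as reals. All other
  memory cells are \<open>0\<close>.
\<close>

definition numbered :: "nat mbc \<Rightarrow> bool" where
  "numbered I \<longleftrightarrow> (\<exists>n. nodes I = {..<n})"

definition mbc_size :: "nat mbc \<Rightarrow> nat" where
  "mbc_size I = card (nodes I)"

definition mbc_encode :: "nat mbc \<Rightarrow> store" where
  "mbc_encode I = (let n = card (nodes I) in
     \<lparr>nmem = (\<lambda>x i.
        if x = ''n'' \<and> i = 0 then n
        else if x = ''adj'' \<and> i < n * n \<and> {i div n, i mod n} \<in> edges I then 1
        else 0),
      rmem = (\<lambda>x i.
        if x = ''cost'' \<and> i < n then cost I i
        else if x = ''budget'' \<and> i = 0 then budget I
        else 0)\<rparr>)"

definition mbc_decode :: "nat mbc \<Rightarrow> store \<Rightarrow> nat set" where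
  "mbc_decode I s = {v \<in> nodes I. nmem s ''sol'' v \<noteq> 0}"

end

theory Submission
  imports Defs
begin

text \<open>
  Paths in a tree are unique, so \<open>GBC V E C\<close> is the number of ordered pairs of distinct nodes minus
  the number of such pairs that lie in a common component of \<open>V - C\<close>; the latter number, \<open>q\<close>, is to
  be minimised. Root the tree. For a block \<open>F\<close> of nodes with root \<open>w\<close> and each pair \<open>(m, q)\<close>, where
  \<open>m\<close> is the size of the component of \<open>w\<close> in \<open>F - D\<close> (0 if \<open>w \<in> D\<close>), it suffices to remember a
  cheapest \<open>D \<subseteq> F\<close>: when two blocks are joined by the edge between their roots, the
  new values are \<open>m1 + m2\<close> (0 if \<open>m1 = 0\<close>) and \<open>q1 + q2 + 2 m1 m2\<close>. There are only polynomially many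
  pairs \<open>(m, q)\<close>, and costs enter only by addition and comparison, so arbitrary real costs do no
  harm. Blocks are merged along the tree edges in the reverse of the order in which a graph search
  discovers the nodes.
\<close>

section \<open>Components of induced subgraphs\<close>

text \<open>End nodes count as nodes of a path, so a pair escapes \<open>C\<close> only if its whole
  path, ends included, avoids \<open>C\<close>; this is why components of \<open>V - C\<close>
  decide everything. One cheapest set per pair \<open>(m, q)\<close> is enough because later merges
  see a block only through that pair: exchanging a set for a cheaper one with the same pair changes
  no later value and cannot raise the cost. The budget therefore enters only when the final table is
  read. Since \<open>m \<le> n\<close> and \<open>q \<le> n * n\<close>, both indices lie below
  \<open>base n = n * n + 1\<close>. As \<open>2 * n \<le> n * n + 1\<close>, the same number bounds
  the slots of all \<open>2 * n - 1\<close> tables, and it is also the common bound on the rounds of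
  every loop. The machine shapes the second half. It cannot multiply, so strides and products are
  read from arrays filled by repeated addition. Time is not tracked through the correctness
  arguments: \<open>steps\<close> reads a polynomial in the loop bound off the program text, and
  each loop only has to be shown to end within \<open>base n\<close> rounds.\<close>

definition adj_in :: "'v set set \<Rightarrow> 'v set \<Rightarrow> ('v \<times> 'v) set" where
  "adj_in E X = {(x, y). {x, y} \<in> E \<and> x \<in> X \<and> y \<in> X}"

text \<open>The guard \<open>x \<in> X\<close> makes the component of a removed node empty, so that
  its size 0 can later signal that the root of a block was removed.\<close>

definition component :: "'v set set \<Rightarrow> 'v set \<Rightarrow> 'v \<Rightarrow> 'v set" where
  "component E X x = {y \<in> X. x \<in> X \<and> (x, y) \<in> (adj_in E X)\<^sup>*}"

text \<open>Ordered pairs, in accordance with the sum in \<open>GBC\<close>; this is the source of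
  the factor 2 in the counting below.\<close>

definition linked_pairs :: "'v set set \<Rightarrow> 'v set \<Rightarrow> ('v \<times> 'v) set" where
  "linked_pairs E X = {(x, y). x \<noteq> y \<and> y \<in> component E X x}"

lemma adj_in_mono: "X \<subseteq> Y \<Longrightarrow> adj_in E X \<subseteq> adj_in E Y"
  by (auto simp: adj_in_def)

lemma sym_adj_in: "sym (adj_in E X)"
  by (auto simp: adj_in_def sym_def insert_commute)

lemma component_self [simp]: "x \<in> component E X x \<longleftrightarrow> x \<in> X"
  by (auto simp: component_def)

lemma component_sym: "x \<in> component E X y \<longleftrightarrow> y \<in> component E X x"
  using sym_rtrancl[OF sym_adj_in[of E X]] by (auto simp: component_def dest: symD)

lemma component_trans: "y \<in> component E X x \<Longrightarrow> z \<in> component E X y \<Longrightarrow> z \<in> component E X x"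
  by (auto simp: component_def)

lemma component_mono: "X \<subseteq> Y \<Longrightarrow> component E X x \<subseteq> component E Y x"
  using rtrancl_mono[OF adj_in_mono[of X Y E]] by (auto simp: component_def)

lemma component_step:
  "y \<in> component E X x \<Longrightarrow> {y, z} \<in> E \<Longrightarrow> z \<in> X \<Longrightarrow> z \<in> component E X x"
  by (auto simp: component_def adj_in_def intro: rtrancl_into_rtrancl)

lemma component_subset: "component E X x \<subseteq> X"
  by (auto simp: component_def)

lemma component_outside: "x \<notin> X \<Longrightarrow> component E X x = {}"
  by (auto simp: component_def)

lemma component_induct [consumes 1, case_names refl step]:
  assumes "y \<in> component E X x"
    and "x \<in> X \<Longrightarrow> P x"
    and "\<And>y z. y \<in> component E X x \<Longrightarrow> P y \<Longrightarrow> {y, z} \<in> E \<Longrightarrow> z \<in> X \<Longrightarrow> P z"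
  shows "P y"
proof -
  have x: "x \<in> X" and r: "(x, y) \<in> (adj_in E X)\<^sup>*"
    using assms(1) by (auto simp: component_def)
  from r have "y \<in> component E X x \<and> P y"
  proof (induction rule: rtrancl_induct)
    case base
    show ?case using x assms(2) by simp
  next
    case (step y z)
    then have "{y, z} \<in> E" "z \<in> X" by (auto simp: adj_in_def)
    then show ?case using step.IH assms(3) component_step by metis
  qed
  then show ?thesis ..
qed

text \<open>A walk can pass between \<open>X\<close> and \<open>Y\<close> only along the edge from
  \<open>u\<close> to \<open>a\<close>. If \<open>u\<close> or \<open>a\<close> has been removed,
  the second part of the union is empty, so one formula covers all cases.\<close>

lemma component_join:
  assumes edge: "{u, a} \<in> E" and x: "x \<in> X" and dis: "X \<inter> Y = {}"
    and only: "\<And>x y. x \<in> X \<Longrightarrow> y \<in> Y \<Longrightarrow> {x, y} \<in> E \<Longrightarrow> x = u \<and> y = a"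
  shows "component E (X \<union> Y) x =
    component E X x \<union> (if u \<in> component E X x then component E Y a else {})" (is "_ = ?R")
proof
  \<comment> \<open>The right side contains \<open>x\<close> and is closed under steps along edges
    inside \<open>X \<union> Y\<close>.\<close>
  show "component E (X \<union> Y) x \<subseteq> ?R"
  proof
    fix y assume "y \<in> component E (X \<union> Y) x"
    then show "y \<in> ?R"
    proof (induction rule: component_induct)
      case refl
      show ?case using x by simp
    next
      case (step y z)
      have sub: "component E X x \<subseteq> X" "component E Y a \<subseteq> Y" by (auto simp: component_subset)
      show ?case
      proof (cases "y \<in> component E X x")
        case True
        then show ?thesis
          using step.hyps sub only[of y z] component_step[OF True] by (cases "z \<in> X") auto
      next
        case False
        then have u: "u \<in> component E X x" and y: "y \<in> component E Y a"
          using step.IH by (auto split: if_splits)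
        then show ?thesis
          using step.hyps sub only[of z y] component_step[OF y] by (cases "z \<in> Y") (auto simp: insert_commute)
      qed
    qed
  qed
next
  have "component E Y a \<subseteq> component E (X \<union> Y) x" if u: "u \<in> component E X x"
  proof
    fix y assume y: "y \<in> component E Y a"
    then have "a \<in> Y" by (auto simp: component_def)
    then have "a \<in> component E (X \<union> Y) x"
      using component_mono[of X "X \<union> Y" E x] u edge by (auto intro: component_step)
    then show "y \<in> component E (X \<union> Y) x"
      using y component_mono[of Y "X \<union> Y" E a] by (auto intro: component_trans)
  qed
  then show "?R \<subseteq> component E (X \<union> Y) x"
    using component_mono[of X "X \<union> Y" E x] by auto
qed

text \<open>A pair that becomes linked must use the bridge, so it has one end in the component of
  \<open>u\<close> and the other in that of \<open>a\<close>; both orders occur.\<close>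

lemma linked_pairs_join:
  assumes edge: "{u, a} \<in> E" and dis: "X \<inter> Y = {}"
    and only: "\<And>x y. x \<in> X \<Longrightarrow> y \<in> Y \<Longrightarrow> {x, y} \<in> E \<Longrightarrow> x = u \<and> y = a"
  shows "linked_pairs E (X \<union> Y) = linked_pairs E X \<union> linked_pairs E Y
    \<union> component E X u \<times> component E Y a \<union> component E Y a \<times> component E X u"
proof -
  have X: "component E (X \<union> Y) x =
      component E X x \<union> (if u \<in> component E X x then component E Y a else {})" if "x \<in> X" for x
    by (rule component_join[OF edge that dis only])
  \<comment> \<open>The situation is symmetric, so \<open>component_join\<close> applies with the
    two sides exchanged.\<close>
  have Y: "component E (X \<union> Y) x =
      component E Y x \<union> (if a \<in> component E Y x then component E X u else {})" if "x \<in> Y" for x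
  proof -
    have "x = a \<and> y = u" if "x \<in> Y" "y \<in> X" "{x, y} \<in> E" for x y
      using only[of y x] that by (simp add: insert_commute)
    moreover have "{a, u} \<in> E" "Y \<inter> X = {}" using edge dis by (auto simp: insert_commute)
    ultimately show ?thesis
      using component_join[of a u E x Y X] that by (simp add: Un_commute)
  qed
  have "(x, y) \<in> linked_pairs E (X \<union> Y) \<longleftrightarrow> (x, y) \<in> linked_pairs E X \<union> linked_pairs E Y
    \<union> component E X u \<times> component E Y a \<union> component E Y a \<times> component E X u" for x y
  proof -
    have sub: "component E X u \<subseteq> X" "component E Y a \<subseteq> Y" by (auto simp: component_subset)
    consider "x \<in> X" "x \<notin> Y" | "x \<in> Y" "x \<notin> X" | "x \<notin> X" "x \<notin> Y" using dis by auto
    then show ?thesis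
    proof cases
      case 1
      then have "component E Y x = {}" "x \<notin> component E Y a" using sub by (auto simp: component_outside)
      then show ?thesis
        using X[OF 1(1)] component_sym[of u E X x] 1 sub dis
        by (auto simp: linked_pairs_def)
    next
      case 2
      then have "component E X x = {}" "x \<notin> component E X u" using sub by (auto simp: component_outside)
      then show ?thesis
        using Y[OF 2(1)] component_sym[of a E Y x] 2 sub dis
        by (auto simp: linked_pairs_def)
    next
      case 3
      then show ?thesis
        using sub by (auto simp: linked_pairs_def component_outside)
    qed
  qed
  then show ?thesis by (metis subrelI subset_antisym)
qed

lemma finite_component: "finite X \<Longrightarrow> finite (component E X x)"
  by (rule finite_subset[OF component_subset])

lemma linked_pairs_subset: "linked_pairs E X \<subseteq> X \<times> X"
  by (auto simp: linked_pairs_def component_def)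

lemma finite_linked_pairs: "finite X \<Longrightarrow> finite (linked_pairs E X)"
  by (rule finite_subset[OF linked_pairs_subset]) simp

lemma card_linked_pairs_join:
  assumes "{u, a} \<in> E" "X \<inter> Y = {}" "finite X" "finite Y"
    and "\<And>x y. x \<in> X \<Longrightarrow> y \<in> Y \<Longrightarrow> {x, y} \<in> E \<Longrightarrow> x = u \<and> y = a"
  shows "card (linked_pairs E (X \<union> Y)) = card (linked_pairs E X) + card (linked_pairs E Y)
    + 2 * (card (component E X u) * card (component E Y a))"
proof -
  let ?P = "linked_pairs E X" and ?Q = "linked_pairs E Y"
  let ?C = "component E X u" and ?D = "component E Y a"
  have sub: "?P \<subseteq> X \<times> X" "?Q \<subseteq> Y \<times> Y" "?C \<subseteq> X" "?D \<subseteq> Y"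
    by (simp_all add: linked_pairs_subset component_subset)
  have fin: "finite ?P" "finite ?Q" "finite ?C" "finite ?D"
    using assms by (simp_all add: finite_linked_pairs finite_component)
  have d1: "?P \<inter> ?Q = {}" "(?P \<union> ?Q) \<inter> ?C \<times> ?D = {}"
    "(?P \<union> ?Q \<union> ?C \<times> ?D) \<inter> ?D \<times> ?C = {}"
    using sub assms(2) by blast+
  have "card (?P \<union> ?Q \<union> ?C \<times> ?D \<union> ?D \<times> ?C)
      = card ?P + card ?Q + card (?C \<times> ?D) + card (?D \<times> ?C)"
    using fin d1 by (simp add: card_Un_disjoint)
  then show ?thesis
    using linked_pairs_join[OF assms(1,2,5)] by (simp add: card_cartesian_product)
qed

section \<open>Paths in trees\<close>

lemma is_path_Cons:
  "is_path X E (x # xs) \<longleftrightarrow> x \<in> X \<and> (xs = [] \<or> x \<notin> set xs \<and> {x, hd xs} \<in> E \<and> is_path X E xs)"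
proof (cases xs)
  case Nil
  then show ?thesis by (simp add: is_path_def)
next
  case (Cons y ys)
  have all_nat: "(\<forall>i. Q i) \<longleftrightarrow> Q 0 \<and> (\<forall>i. Q (Suc i))" for Q :: "nat \<Rightarrow> bool"
    by (metis nat.exhaust)
  have "(\<forall>i. Suc i < length (x # xs) \<longrightarrow> {(x # xs) ! i, (x # xs) ! Suc i} \<in> E)
    \<longleftrightarrow> {x, hd xs} \<in> E \<and> (\<forall>i. Suc i < length xs \<longrightarrow> {xs ! i, xs ! Suc i} \<in> E)"
    by (subst all_nat) (simp add: Cons)
  then show ?thesis using Cons by (auto simp: is_path_def)
qed

lemma is_path_mono: "is_path X E xs \<Longrightarrow> X \<subseteq> Y \<Longrightarrow> E \<subseteq> F \<Longrightarrow> is_path Y F xs"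
  by (auto simp: is_path_def)

lemma is_path_suffix: "is_path X E (xs @ ys) \<Longrightarrow> ys \<noteq> [] \<Longrightarrow> is_path X E ys"
  by (induction xs) (auto simp: is_path_Cons)

lemma is_path_component: "is_path X E xs \<Longrightarrow> last xs \<in> component E X (hd xs)"
proof (induction xs)
  case (Cons x xs)
  show ?case
  proof (cases "xs = []")
    case True
    then show ?thesis using Cons.prems by (simp add: is_path_Cons)
  next
    case False
    then have p: "is_path X E xs" and x: "x \<in> X" "{x, hd xs} \<in> E"
      using Cons.prems by (auto simp: is_path_Cons)
    have l: "last xs \<in> component E X (hd xs)" using Cons.IH[OF p] .
    then have "hd xs \<in> X" by (auto simp: component_def)
    then have "hd xs \<in> component E X x"
      using x component_step[of x E X x "hd xs"] by simp
    then show ?thesis using l False by (auto intro: component_trans)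
  qed
qed (simp add: is_path_def)

text \<open>Walks grow at their far end, lists at their head, so the path runs from \<open>y\<close>
  back to \<open>x\<close>. If the new node already lies on the path, the suffix starting there is
  taken, which keeps the nodes distinct.\<close>

lemma component_path:
  assumes "y \<in> component E X x"
  obtains xs where "is_path X E xs" "hd xs = y" "last xs = x"
proof -
  from assms have "\<exists>xs. is_path X E xs \<and> hd xs = y \<and> last xs = x"
  proof (induction rule: component_induct)
    case refl
    then show ?case by (intro exI[of _ "[x]"]) (simp add: is_path_Cons)
  next
    case (step y z)
    then obtain xs where xs: "is_path X E xs" "hd xs = y" "last xs = x" by blast
    then have ne: "xs \<noteq> []" by (auto simp: is_path_def)
    show ?case
    proof (cases "z \<in> set xs")
      case True
      then obtain as bs where s: "xs = as @ z # bs" by (auto simp: in_set_conv_decomp)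
      then show ?thesis
        using xs is_path_suffix[of X E as "z # bs"] by (intro exI[of _ "z # bs"]) auto
    next
      case False
      then show ?thesis
        using xs ne step.hyps
        by (intro exI[of _ "z # xs"]) (auto simp: is_path_Cons insert_commute)
    qed
  qed
  then show thesis using that by blast
qed

lemma st_paths_component: "st_paths X E s t \<noteq> {} \<longleftrightarrow> t \<in> component E X s"
proof
  assume "st_paths X E s t \<noteq> {}"
  then show "t \<in> component E X s"
    using is_path_component by (fastforce simp: st_paths_def)
next
  assume "t \<in> component E X s"
  then have "s \<in> component E X t" by (simp add: component_sym)
  then obtain xs where "is_path X E xs" "hd xs = s" "last xs = t" by (rule component_path)
  then show "st_paths X E s t \<noteq> {}" by (auto simp: st_paths_def)
qed

text \<open>A path from \<open>y\<close> to \<open>x\<close> that avoids the edge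
  \<open>{x, y}\<close> has at least three nodes, and that edge closes it to a cycle.\<close>

lemma no_second_link:
  assumes acyc: "\<nexists>xs. is_cycle V E xs" and e: "{x, y} \<in> E" and F: "F \<subseteq> E" "{x, y} \<notin> F"
    and "x \<noteq> y"
  shows "y \<notin> component F V x"
proof
  assume "y \<in> component F V x"
  then obtain xs where xs: "is_path V F xs" "hd xs = y" "last xs = x" by (rule component_path)
  have "3 \<le> length xs"
  proof -
    \<comment> \<open>The case rule of \<open>remdups_adj\<close> splits lists into those with no
      element, one element, and at least two.\<close>
    consider "xs = []" | v where "xs = [v]" | v w where "xs = [v, w]" | "3 \<le> length xs"
      by (cases xs rule: remdups_adj.cases) (auto simp: Suc_le_eq neq_Nil_conv, metis length_greater_0_conv list.exhaust)
    then show ?thesis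
      using xs \<open>x \<noteq> y\<close> F(2) by cases (auto simp: is_path_Cons insert_commute is_path_def)
  qed
  then have "is_cycle V E xs"
    using xs e is_path_mono[OF xs(1) _ F(1)] by (auto simp: is_cycle_def)
  then show False using acyc by blast
qed

text \<open>At the first place where two paths part, the two successors of \<open>x\<close> are
  still connected through the common end without \<open>x\<close>; a path between them together with
  \<open>x\<close> is a cycle.\<close>

lemma unique_path:
  assumes acyc: "\<nexists>xs. is_cycle V E xs"
  shows "is_path V E xs \<Longrightarrow> is_path V E ys \<Longrightarrow> hd xs = hd ys \<Longrightarrow> last xs = last ys \<Longrightarrow> xs = ys"
proof (induction xs arbitrary: ys)
  case Nil
  then show ?case by (simp add: is_path_def)
next
  case (Cons x xs)
  then obtain ys' where ys: "ys = x # ys'" by (cases ys) (auto simp: is_path_def)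
  note px = Cons.prems(1)[unfolded is_path_Cons] and py = Cons.prems(2)[unfolded ys is_path_Cons]
  show ?case
  proof (cases "xs = [] \<or> ys' = []")
    case True
    \<comment> \<open>If only one path stopped at \<open>x\<close>, the other would have to end in
      \<open>x\<close> as well, although \<open>x\<close> does not occur in its tail.\<close>
    then have "xs = [] \<and> ys' = []"
      using Cons.prems(4) px py ys last_in_set[of xs] last_in_set[of ys'] by (auto split: if_splits)
    then show ?thesis using ys by simp
  next
    case False
    then have p: "is_path V E xs" "x \<notin> set xs" "{x, hd xs} \<in> E"
      and q: "is_path V E ys'" "x \<notin> set ys'" "{x, hd ys'} \<in> E" and l: "last xs = last ys'"
      using px py Cons.prems(4) ys by auto
    have "hd xs = hd ys'"
    proof (rule ccontr)
      assume ne: "hd xs \<noteq> hd ys'"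
      \<comment> \<open>Working in \<open>V - {x}\<close> yields a connecting path that avoids
        \<open>x\<close>.\<close>
      have "is_path (V - {x}) E xs" "is_path (V - {x}) E ys'"
        using p q by (auto simp: is_path_def)
      then have "last xs \<in> component E (V - {x}) (hd xs)" "last xs \<in> component E (V - {x}) (hd ys')"
        using is_path_component l by metis+
      then have "hd xs \<in> component E (V - {x}) (hd ys')"
        by (meson component_sym component_trans)
      then obtain zs where zs: "is_path (V - {x}) E zs" "hd zs = hd xs" "last zs = hd ys'"
        by (rule component_path)
      then have zs': "is_path V E zs" "x \<notin> set zs" "zs \<noteq> []" by (auto simp: is_path_def)
      have "2 \<le> length zs"
        using zs ne zs'(3) by (cases zs) (auto simp: Suc_le_eq)
      then have "is_cycle V E (x # zs)"
        using zs zs' p q px by (auto simp: is_cycle_def is_path_Cons insert_commute)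
      then show False using acyc by blast
    qed
    then show ?thesis using Cons.IH p q l ys by blast
  qed
qed

text \<open>The only path is also the only shortest one. Paths avoiding \<open>C\<close> are exactly
  the paths of the graph induced on \<open>V - C\<close>, so the path misses \<open>C\<close> iff
  \<open>s\<close> and \<open>t\<close> stay connected there.\<close>

lemma card_shortest_tree:
  assumes tree: "is_tree V E" and "s \<in> V" "t \<in> V"
  shows "num_sp V E s t = 1"
    and "num_sp_via V E s t C = (if t \<in> component E (V - C) s then 0 else 1)"
proof -
  have acyc: "\<nexists>xs. is_cycle V E xs" and "st_paths V E s t \<noteq> {}"
    using assms by (auto simp: is_tree_def connected_graph_def)
  then obtain xs where xs: "xs \<in> st_paths V E s t" by blast
  have uniq: "st_paths V E s t = {xs}"
    using xs unique_path[OF acyc] by (auto simp: st_paths_def)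
  have sp: "shortest_paths V E s t = {xs}"
    unfolding shortest_paths_def uniq by auto
  show "num_sp V E s t = 1" by (simp add: num_sp_def sp)
  have "st_paths (V - C) E s t = {zs \<in> st_paths V E s t. set zs \<inter> C = {}}"
    by (auto simp: st_paths_def is_path_def)
  then have "t \<in> component E (V - C) s \<longleftrightarrow> set xs \<inter> C = {}"
    unfolding st_paths_component[symmetric] uniq by auto
  moreover have "{zs \<in> {xs}. set zs \<inter> C \<noteq> {}} = (if set xs \<inter> C = {} then {} else {xs})"
    by auto
  ultimately show "num_sp_via V E s t C = (if t \<in> component E (V - C) s then 0 else 1)"
    by (simp add: num_sp_via_def sp)
qed

lemma GBC_tree:
  assumes tree: "is_tree V E"
  shows "GBC V E C = real (card {(s, t). s \<in> V \<and> t \<in> V \<and> s \<noteq> t})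
    - real (card (linked_pairs E (V - C)))"
proof -
  let ?P = "{(s, t). s \<in> V \<and> t \<in> V \<and> s \<noteq> t}"
  have "finite V" using tree by (simp add: is_tree_def ugraph_def)
  then have fin: "finite ?P" by (rule_tac finite_subset[of _ "V \<times> V"]) auto
  have "GBC V E C = (\<Sum>(s, t)\<in>?P. if t \<in> component E (V - C) s then 0 else 1)"
    unfolding GBC_def by (intro sum.cong) (auto simp: card_shortest_tree[OF tree])
  also have "\<dots> = (\<Sum>p\<in>?P - linked_pairs E (V - C). 1)"
    by (rule sum.mono_neutral_cong_right) (use fin in \<open>auto simp: linked_pairs_def split: if_splits\<close>)
  also have "\<dots> = real (card (?P - linked_pairs E (V - C)))" by simp
  finally have gbc: "GBC V E C = real (card (?P - linked_pairs E (V - C)))" .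
  have "card (?P - linked_pairs E (V - C)) = card ?P - card (linked_pairs E (V - C))"
    by (rule card_Diff_subset)
      (use \<open>finite V\<close> finite_linked_pairs[of "V - C" E] in
        \<open>auto simp: linked_pairs_def component_def\<close>)
  moreover have "card (linked_pairs E (V - C)) \<le> card ?P"
    by (rule card_mono[OF fin]) (auto simp: linked_pairs_def component_def)
  ultimately show ?thesis using gbc by (simp add: of_nat_diff)
qed

section \<open>Families of candidate solutions\<close>

text \<open>The set \<open>D\<close> is kept beside its two values: the table entries must be
  compared by the cost of \<open>D\<close>, and the final answer is such a set.\<close>

definition candidates :: "'v set set \<Rightarrow> 'v set \<Rightarrow> 'v \<Rightarrow> (nat \<times> nat \<times> 'v set) set" where
  "candidates E F w =
    {(card (component E (F - D) w), card (linked_pairs E (F - D)), D) | D. D \<subseteq> F}"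

text \<open>Only \<open>m1 = 0\<close> needs a separate case, because the root of the first block
  becomes the root of the union. If the second root was removed, then \<open>m2 = 0\<close> and the
  general formula is already right.\<close>

fun combine :: "nat \<times> nat \<times> 'v set \<Rightarrow> nat \<times> nat \<times> 'v set \<Rightarrow> nat \<times> nat \<times> 'v set" where
  "combine (m1, q1, D1) (m2, q2, D2) =
    (if m1 = 0 then 0 else m1 + m2, q1 + q2 + 2 * (m1 * m2), D1 \<union> D2)"

lemma candidates_single: "candidates E {w} w = {(1, 0, {}), (0, 0, {w})}"
proof -
  have "component E {w} w = {w}" using component_subset[of E "{w}" w] component_self[of w E "{w}"] by auto
  moreover have "linked_pairs E {w} = {}" using linked_pairs_subset[of E "{w}"] by (auto simp: linked_pairs_def)
  moreover have "linked_pairs E {} = {}" using linked_pairs_subset[of E "{}"] by auto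
  moreover have "{D. D \<subseteq> {w}} = {{}, {w}}" by auto
  ultimately show ?thesis by (auto simp: candidates_def subset_singleton_iff component_outside)
qed

text \<open>A subset of \<open>F \<union> G\<close> is the union of its traces on \<open>F\<close>
  and \<open>G\<close>, and removing nodes creates no edges. So what is left of the two blocks still
  meets at most along \<open>{u, a}\<close>, and the join formulas apply.\<close>

lemma candidates_join:
  assumes edge: "{u, a} \<in> E" and dis: "F \<inter> G = {}" and fin: "finite F" "finite G"
    and only: "\<And>x y. x \<in> F \<Longrightarrow> y \<in> G \<Longrightarrow> {x, y} \<in> E \<Longrightarrow> x = u \<and> y = a"
    and mem: "u \<in> F" "a \<in> G"
  shows "candidates E (F \<union> G) u =
    {combine p q | p q. p \<in> candidates E F u \<and> q \<in> candidates E G a}"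
proof -
  let ?c = "\<lambda>F w D. (card (component E (F - D) w), card (linked_pairs E (F - D)), D)"
  have key: "?c (F \<union> G) u (D1 \<union> D2) = combine (?c F u D1) (?c G a D2)"
    if "D1 \<subseteq> F" "D2 \<subseteq> G" for D1 D2
  proof -
    let ?X = "F - D1" and ?Y = "G - D2"
    have un: "(F \<union> G) - (D1 \<union> D2) = ?X \<union> ?Y" using that dis by auto
    have XY: "?X \<inter> ?Y = {}" using dis by auto
    have only': "x = u \<and> y = a" if "x \<in> ?X" "y \<in> ?Y" "{x, y} \<in> E" for x y
      using only that by auto
    have q: "card (linked_pairs E (?X \<union> ?Y)) = card (linked_pairs E ?X) + card (linked_pairs E ?Y)
      + 2 * (card (component E ?X u) * card (component E ?Y a))"
      by (rule card_linked_pairs_join[OF edge XY _ _ only']) (use fin in auto)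
    have m: "card (component E (?X \<union> ?Y) u) =
      (if card (component E ?X u) = 0 then 0
       else card (component E ?X u) + card (component E ?Y a))"
    proof (cases "u \<in> ?X")
      case True
      then have "component E (?X \<union> ?Y) u = component E ?X u \<union> component E ?Y a"
        using component_join[OF edge True XY only'] by simp
      moreover have "component E ?X u \<inter> component E ?Y a = {}"
        using component_subset[of E ?X u] component_subset[of E ?Y a] XY by blast
      \<comment> \<open>A remaining root lies in its own finite component; hence the test
        \<open>m1 = 0\<close> recognises exactly the removed roots.\<close>
      moreover have "card (component E ?X u) \<noteq> 0"
        using True component_self[of u E ?X] fin(1)
        by (metis Diff_iff card_0_eq empty_iff finite_Diff finite_component)
      ultimately show ?thesis
        using fin by (simp add: card_Un_disjoint finite_component)
    next
      case False
      \<comment> \<open>Here \<open>u \<in> F\<close> matters: disjointness keeps a removed root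
        from reappearing in \<open>G\<close>.\<close>
      then have "u \<notin> ?X \<union> ?Y" using mem dis by auto
      then show ?thesis using False by (simp add: component_outside)
    qed
    show ?thesis unfolding un q m by simp
  qed
  show ?thesis
  proof (intro set_eqI iffI)
    fix r assume "r \<in> candidates E (F \<union> G) u"
    then obtain D where D: "D \<subseteq> F \<union> G" "r = ?c (F \<union> G) u D" by (auto simp: candidates_def)
    have "D = (D \<inter> F) \<union> (D \<inter> G)" using D by auto
    then have "r = combine (?c F u (D \<inter> F)) (?c G a (D \<inter> G))"
      using key[of "D \<inter> F" "D \<inter> G"] D(2) by auto
    moreover have "?c F u (D \<inter> F) \<in> candidates E F u" "?c G a (D \<inter> G) \<in> candidates E G a"
      by (auto simp: candidates_def)
    ultimately show "r \<in> {combine p q | p q. p \<in> candidates E F u \<and> q \<in> candidates E G a}"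
      by blast
  next
    fix r assume "r \<in> {combine p q | p q. p \<in> candidates E F u \<and> q \<in> candidates E G a}"
    then obtain D1 D2 where "D1 \<subseteq> F" "D2 \<subseteq> G" "r = combine (?c F u D1) (?c G a D2)"
      by (auto simp: candidates_def simp del: combine.simps)
    then show "r \<in> candidates E (F \<union> G) u"
      using key[of D1 D2] by (auto simp: candidates_def)
  qed
qed

text \<open>These bounds make square tables with indices below \<open>base n\<close> large
  enough.\<close>

lemma candidates_bound:
  assumes "(m, q, D) \<in> candidates E F w" "F \<subseteq> {..<n}"
  shows "m \<le> n" "q \<le> n * n" "D \<subseteq> F"
proof -
  from assms have D: "D \<subseteq> F" and m: "m = card (component E (F - D) w)"
    and q: "q = card (linked_pairs E (F - D))" by (auto simp: candidates_def)
  have "component E (F - D) w \<subseteq> {..<n}" using component_subset[of E "F - D" w] assms(2) by auto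
  then show "m \<le> n" using m card_mono[of "{..<n}"] by fastforce
  have "linked_pairs E (F - D) \<subseteq> {..<n} \<times> {..<n}"
    using linked_pairs_subset[of E "F - D"] assms(2) by blast
  then have "card (linked_pairs E (F - D)) \<le> card ({..<n} \<times> {..<n})"
    by (intro card_mono) auto
  then show "q \<le> n * n" using q by (simp add: card_cartesian_product)
  show "D \<subseteq> F" by (rule D)
qed

section \<open>Tables of cheapest candidates\<close>

type_synonym table = "nat \<Rightarrow> nat \<Rightarrow> (real \<times> nat set) option"

text \<open>Soundness and domination together say that each entry is a cheapest candidate for its
  index. Soundness is asked only below \<open>B\<close> since larger indices would address cells of
  other entries; completeness ensures that no candidate falls outside.\<close>

definition represents ::
    "nat \<Rightarrow> (nat \<Rightarrow> real) \<Rightarrow> table \<Rightarrow> (nat \<times> nat \<times> nat set) set \<Rightarrow> bool" where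
  "represents B c t F \<longleftrightarrow>
    (\<forall>m<B. \<forall>q<B. \<forall>r D. t m q = Some (r, D) \<longrightarrow> (m, q, D) \<in> F \<and> r = sum c D) \<and>
    (\<forall>m q D. (m, q, D) \<in> F \<longrightarrow> m < B \<and> q < B \<and> (\<exists>r D'. t m q = Some (r, D') \<and> r \<le> sum c D))"

definition improves :: "table \<Rightarrow> nat \<Rightarrow> nat \<Rightarrow> real \<Rightarrow> bool" where
  "improves t m q r \<longleftrightarrow> (case t m q of None \<Rightarrow> True | Some (r', _) \<Rightarrow> r < r')"

lemma representsI:
  assumes "\<And>m q r D. m < B \<Longrightarrow> q < B \<Longrightarrow> t m q = Some (r, D) \<Longrightarrow> (m, q, D) \<in> F \<and> r = sum c D"
    and "\<And>m q D. (m, q, D) \<in> F \<Longrightarrow>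
      m < B \<and> q < B \<and> (\<exists>r D'. t m q = Some (r, D') \<and> r \<le> sum c D)"
  shows "represents B c t F"
  unfolding represents_def using assms by blast

lemma represents_sound:
  assumes "represents B c t F" "m < B" "q < B" "t m q = Some (r, D)"
  shows "(m, q, D) \<in> F" "r = sum c D"
  using assms unfolding represents_def by blast+

lemma represents_complete:
  assumes "represents B c t F" "(m, q, D) \<in> F"
  obtains r D' where "m < B" "q < B" "t m q = Some (r, D')" "r \<le> sum c D"
  using assms unfolding represents_def by blast

lemma represents_cong:
  assumes "represents B c t F" "\<And>m q. m < B \<Longrightarrow> q < B \<Longrightarrow> t' m q = t m q"
  shows "represents B c t' F"
proof (rule representsI)
  fix m q D assume "(m, q, D) \<in> F"
  with assms(1) show "m < B \<and> q < B \<and> (\<exists>r D'. t' m q = Some (r, D') \<and> r \<le> sum c D)"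
    by (rule represents_complete) (simp add: assms(2))
qed (use assms(2) represents_sound[OF assms(1)] in force)

lemma represents_insert:
  assumes rep: "represents B c t F" and mq: "m < B" "q < B" and r: "r = sum c D"
    and t': "\<And>m' q'. m' < B \<Longrightarrow> q' < B \<Longrightarrow>
      t' m' q' = (if m' = m \<and> q' = q \<and> improves t m q r then Some (r, D) else t m' q')"
  shows "represents B c t' (insert (m, q, D) F)"
proof (rule representsI)
  fix m' q' r' D' assume m'q': "m' < B" "q' < B" and t'_eq: "t' m' q' = Some (r', D')"
  show "(m', q', D') \<in> insert (m, q, D) F \<and> r' = sum c D'"
  proof (cases "m' = m \<and> q' = q \<and> improves t m q r")
    case True
    then have "t' m' q' = Some (r, D)" by (subst t'[OF m'q']) simp
    then show ?thesis using t'_eq True r by auto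
  next
    case False
    then have "t m' q' = Some (r', D')" using t'_eq t'[OF m'q'] by (simp only: if_False)
    then show ?thesis using represents_sound[OF rep m'q'] by simp
  qed
next
  fix m' q' D' assume mem: "(m', q', D') \<in> insert (m, q, D) F"
  show "m' < B \<and> q' < B \<and> (\<exists>r' D''. t' m' q' = Some (r', D'') \<and> r' \<le> sum c D')"
  proof (cases "(m', q', D') = (m, q, D)")
    case True
    then show ?thesis
      using mq r t'[OF mq] by (cases "improves t m q r") (auto simp: improves_def split: option.splits)
  next
    case False
    then have "(m', q', D') \<in> F" using mem by auto
    with rep obtain r' D'' where *: "m' < B" "q' < B" "t m' q' = Some (r', D'')" "r' \<le> sum c D'"
      by (rule represents_complete)
    show ?thesis
    proof (cases "m' = m \<and> q' = q \<and> improves t m q r")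
      case True
      then have "r < r'" using *(3) by (simp add: improves_def)
      moreover have "t' m' q' = Some (r, D)" using True by (subst t'[OF *(1,2)]) simp
      ultimately show ?thesis using * by auto
    next
      case False
      then show ?thesis using * t'[OF *(1,2)] by auto
    qed
  qed
qed

text \<open>This is the exchange argument behind the dynamic program. The table \<open>t\<close> is
  built only from stored sets, not from all candidates. Replacing both parts of a combination by the
  stored sets with the same indices keeps the result index, and costs add up over disjoint blocks,
  so the total does not grow.\<close>

lemma represents_combine:
  assumes t1: "represents B c t1 F1" and t2: "represents B c t2 F2"
    and t: "represents B c t {combine (m1, q1, D1) (m2, q2, D2) | m1 q1 r1 D1 m2 q2 r2 D2.
      m1 < B \<and> q1 < B \<and> m2 < B \<and> q2 < B \<and>
      t1 m1 q1 = Some (r1, D1) \<and> t2 m2 q2 = Some (r2, D2)}" (is "represents B c t ?R")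
    and sub: "\<And>m q D. (m, q, D) \<in> F1 \<Longrightarrow> D \<subseteq> X" "\<And>m q D. (m, q, D) \<in> F2 \<Longrightarrow> D \<subseteq> Y"
    and dis: "X \<inter> Y = {}" and fin: "finite X" "finite Y"
  shows "represents B c t {combine p q | p q. p \<in> F1 \<and> q \<in> F2}" (is "represents B c t ?G")
proof -
  have sum_un: "sum c (D1 \<union> D2) = sum c D1 + sum c D2"
    if "(m1, q1, D1) \<in> F1" "(m2, q2, D2) \<in> F2" for m1 q1 D1 m2 q2 D2
  proof -
    have "D1 \<subseteq> X" "D2 \<subseteq> Y" using sub that by blast+
    then show ?thesis using dis fin by (intro sum.union_disjoint) (auto intro: finite_subset)
  qed
  have RG: "p \<in> ?G" if p: "p \<in> ?R" for p
  proof -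
    from p obtain m1 q1 r1 D1 m2 q2 r2 D2 where *: "m1 < B" "q1 < B" "m2 < B" "q2 < B"
      "t1 m1 q1 = Some (r1, D1)" "t2 m2 q2 = Some (r2, D2)"
      "p = combine (m1, q1, D1) (m2, q2, D2)" by blast
    have "(m1, q1, D1) \<in> F1" "(m2, q2, D2) \<in> F2"
      using * represents_sound(1)[OF t1] represents_sound(1)[OF t2] by simp_all
    then show ?thesis using *(7) by blast
  qed
  show ?thesis
  proof (rule representsI)
    fix m q r D assume "m < B" "q < B" "t m q = Some (r, D)"
    then show "(m, q, D) \<in> ?G \<and> r = sum c D" using represents_sound[OF t] RG by blast
  next
    fix m q D assume mem: "(m, q, D) \<in> ?G"
    obtain m1 q1 D1 m2 q2 D2 where
      p: "(m1, q1, D1) \<in> F1" "(m2, q2, D2) \<in> F2" and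
      e: "(m, q, D) = combine (m1, q1, D1) (m2, q2, D2)"
      using mem by (auto simp del: combine.simps)
    from t1 p(1) obtain r1 D1' where
      1: "m1 < B" "q1 < B" "t1 m1 q1 = Some (r1, D1')" "r1 \<le> sum c D1"
      by (rule represents_complete)
    from t2 p(2) obtain r2 D2' where
      2: "m2 < B" "q2 < B" "t2 m2 q2 = Some (r2, D2')" "r2 \<le> sum c D2"
      by (rule represents_complete)
    note p' = represents_sound[OF t1 1(1-3)] represents_sound[OF t2 2(1-3)]
    \<comment> \<open>The first two components of \<open>combine\<close> do not depend on the node
      sets, so the exchanged sets land at the same index \<open>(m, q)\<close>.\<close>
    have "combine (m1, q1, D1') (m2, q2, D2') \<in> ?R" using 1 2 by blast
    then have "(m, q, D1' \<union> D2') \<in> ?R" using e by simp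
    with t obtain r' D' where
      r': "m < B" "q < B" "t m q = Some (r', D')" "r' \<le> sum c (D1' \<union> D2')"
      by (rule represents_complete)
    have "sum c (D1' \<union> D2') \<le> sum c D"
      using sum_un[OF p'(1,3)] sum_un[OF p] p' 1(4) 2(4) e by simp
    then show "m < B \<and> q < B \<and> (\<exists>r' D'. t m q = Some (r', D') \<and> r' \<le> sum c D)"
      using r' by force
  qed
qed

section \<open>Search order and merging\<close>

text \<open>Here \<open>ord k\<close> is a node, but \<open>par k\<close> is the position in the
  order, not the node, from which \<open>ord k\<close> was discovered. Position 0 is the
  root.\<close>

definition search_order :: "nat set set \<Rightarrow> nat \<Rightarrow> (nat \<Rightarrow> nat) \<Rightarrow> (nat \<Rightarrow> nat) \<Rightarrow> nat \<Rightarrow> bool" where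
  "search_order E n ord par K \<longleftrightarrow>
    ord ` {..<K} \<subseteq> {..<n} \<and> inj_on ord {..<K} \<and>
    (\<forall>k. 0 < k \<longrightarrow> k < K \<longrightarrow> par k < k \<and> {ord (par k), ord k} \<in> E)"

text \<open>If no edge left the discovered set, the component of \<open>ord 0\<close> would stay
  inside it, yet by connectedness this component contains all \<open>n\<close> nodes.\<close>

lemma search_order_extend:
  assumes "connected_graph {..<n} E" and so: "search_order E n ord par K" and K: "0 < K" "K < n"
  shows "\<exists>i<K. \<exists>v<n. v \<notin> ord ` {..<K} \<and> {ord i, v} \<in> E"
proof (rule ccontr)
  assume no: "\<not> ?thesis"
  have sub: "ord ` {..<K} \<subseteq> {..<n}" using so by (auto simp: search_order_def)
  have all: "v \<in> ord ` {..<K}" if "v \<in> component E {..<n} (ord 0)" for v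
    using that
  proof (induction rule: component_induct)
    case refl
    then show ?case using K by auto
  next
    case (step y z)
    then show ?case using no by auto
  qed
  have "v \<in> component E {..<n} (ord 0)" if "v < n" for v
  proof -
    have "ord 0 \<in> {..<n}" using sub K by auto
    then have "st_paths {..<n} E (ord 0) v \<noteq> {}"
      using assms(1) that by (auto simp: connected_graph_def)
    then show ?thesis by (simp add: st_paths_component)
  qed
  then have "{..<n} \<subseteq> ord ` {..<K}" using all by auto
  then have "n \<le> card (ord ` {..<K})" using card_mono[of "ord ` {..<K}" "{..<n}"] by simp
  also have "\<dots> \<le> K" using card_image_le[of "{..<K}" ord] by simp
  finally show False using K by simp
qed

text \<open>The search edges alone connect all nodes. Any further edge would join two nodes that are
  connected without it, contradicting acyclicity.\<close>

lemma search_order_edges: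
  assumes tree: "is_tree {..<n} E" and so: "search_order E n ord par n"
    and e: "e \<in> E"
  shows "\<exists>k. 0 < k \<and> k < n \<and> e = {ord (par k), ord k}"
proof (rule ccontr)
  assume no: "\<not> ?thesis"
  obtain x y where xy: "x < n" "y < n" "x \<noteq> y" "e = {x, y}"
    using tree e by (fastforce simp: is_tree_def ugraph_def)
  let ?F = "E - {e}"
  have "card (ord ` {..<n}) = n" using so by (simp add: search_order_def card_image)
  then have surj: "ord ` {..<n} = {..<n}"
    using so by (intro card_subset_eq) (auto simp: search_order_def)
  have conn: "k < n \<Longrightarrow> ord k \<in> component ?F {..<n} (ord 0)" for k
  proof (induction k rule: less_induct)
    case (less k)
    show ?case
    proof (cases "k = 0")
      case True
      then show ?thesis using surj less.prems by auto
    next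
      case False
      then have p: "par k < k" "{ord (par k), ord k} \<in> E"
        using so less.prems by (auto simp: search_order_def)
      then have "{ord (par k), ord k} \<in> ?F" using no less.prems False by auto
      moreover have "ord k < n" using surj less.prems by auto
      ultimately show ?thesis
        using component_step[OF less.IH[of "par k"]] p less.prems by simp
    qed
  qed
  have "x \<in> component ?F {..<n} (ord 0)" "y \<in> component ?F {..<n} (ord 0)"
    using conn surj xy by (metis imageE lessThan_iff)+
  then have "y \<in> component ?F {..<n} x" by (meson component_sym component_trans)
  then show False
    using no_second_link[of "{..<n}" E x y ?F] tree xy e by (auto simp: is_tree_def)
qed

text \<open>The tables still to be merged are those of the blocks \<open>bk i\<close> for \<open>i < k\<close>, where \<open>bk i\<close>
  is rooted at \<open>ord i\<close> and contains the nodes \<open>ord j\<close> with \<open>k \<le> j\<close> that were merged into it.\<close>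

definition blocks ::
    "nat \<Rightarrow> (nat \<Rightarrow> nat) \<Rightarrow> (nat \<Rightarrow> nat) \<Rightarrow> nat \<Rightarrow> (nat \<Rightarrow> nat set) \<Rightarrow> bool" where
  "blocks n ord par k bk \<longleftrightarrow>
    (\<forall>i<k. ord i \<in> bk i) \<and> (\<forall>i<k. \<forall>j<k. i \<noteq> j \<longrightarrow> bk i \<inter> bk j = {}) \<and>
    (\<Union>i<k. bk i) = {..<n} \<and>
    (\<forall>j. k \<le> j \<longrightarrow> j < n \<longrightarrow> (\<exists>i<k. ord j \<in> bk i \<and> ord (par j) \<in> bk i))"

lemma blocks_init:
  assumes "search_order E n ord par n"
  shows "blocks n ord par n (\<lambda>i. {ord i})"
proof -
  have "card (ord ` {..<n}) = n" using assms by (simp add: search_order_def card_image)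
  then have "ord ` {..<n} = {..<n}"
    using assms by (intro card_subset_eq) (auto simp: search_order_def)
  then show ?thesis
    using assms by (auto simp: blocks_def search_order_def inj_on_def)
qed

text \<open>This provides the assumption \<open>only\<close> of \<open>candidates_join\<close>. The
  edge belongs to some position \<open>j\<close>. For \<open>j > k\<close> both its ends lie in one
  block; for \<open>j \<le> k\<close> both ends are block roots, and \<open>par j < j\<close> leaves
  only \<open>j = k\<close>.\<close>

lemma blocks_edge:
  assumes tree: "is_tree {..<n} E" and so: "search_order E n ord par n"
    and bk: "blocks n ord par (Suc k) bk" and k: "0 < k" "k < n"
    and x: "x \<in> bk (par k)" and y: "y \<in> bk k" and e: "{x, y} \<in> E"
  shows "x = ord (par k) \<and> y = ord k"
proof -
  have pk: "par k < k" using so k by (auto simp: search_order_def)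
  obtain j where j: "0 < j" "j < n" "{x, y} = {ord (par j), ord j}"
    using search_order_edges[OF tree so e] by blast
  have pj: "par j < j" using so j by (auto simp: search_order_def)
  have root: "ord i \<in> bk i" if "i \<le> k" for i using bk that by (auto simp: blocks_def)
  have dis: "i = i'" if "v \<in> bk i" "v \<in> bk i'" "i \<le> k" "i' \<le> k" for v i i'
    using bk that unfolding blocks_def less_Suc_eq_le by blast
  show ?thesis
  proof (cases "k < j")
    case True
    then obtain i where "i \<le> k" "ord j \<in> bk i" "ord (par j) \<in> bk i"
      using bk j unfolding blocks_def by (metis Suc_leI less_Suc_eq_le)
    then have "x \<in> bk i" "y \<in> bk i" "i \<le> k" using j(3) by (auto simp: doubleton_eq_iff)
    then have "i = par k" "i = k" using dis x y pk by force+
    then show ?thesis using pk by simp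
  next
    case False
    then have jk: "j \<le> k" "par j \<le> k" using pj by auto
    consider "x = ord (par j)" "y = ord j" | "x = ord j" "y = ord (par j)"
      using j(3) by (auto simp: doubleton_eq_iff)
    then show ?thesis
    proof cases
      case 1
      then have "j = k" using dis[OF y, of j] root[of j] jk by simp
      then show ?thesis using 1 by simp
    next
      case 2
      then have "par j = k" using dis[OF y, of "par j"] root[of "par j"] jk by simp
      then show ?thesis using pj jk by simp
    qed
  qed
qed

lemma blocks_merge:
  assumes so: "search_order E n ord par n"
    and bk: "blocks n ord par (Suc k) bk" and k: "0 < k" "k < n"
  shows "blocks n ord par k (bk(par k := bk (par k) \<union> bk k))"
proof -
  have pk: "par k < k" using so k by (auto simp: search_order_def)
  let ?b = "bk(par k := bk (par k) \<union> bk k)"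
  have root: "ord i \<in> bk i" if "i \<le> k" for i using bk that by (auto simp: blocks_def)
  have dis: "i = i'" if "v \<in> bk i" "v \<in> bk i'" "i \<le> k" "i' \<le> k" for v i i'
    using bk that unfolding blocks_def less_Suc_eq_le by blast
  have un: "(\<Union>i<Suc k. bk i) = {..<n}"
    and later: "\<forall>j. Suc k \<le> j \<longrightarrow> j < n \<longrightarrow> (\<exists>i<Suc k. ord j \<in> bk i \<and> ord (par j) \<in> bk i)"
    using bk unfolding blocks_def by blast+
  have "(\<Union>i<k. ?b i) = (\<Union>i<Suc k. bk i)"
  proof (intro set_eqI iffI)
    fix v assume "v \<in> (\<Union>i<Suc k. bk i)"
    then obtain i where i: "i \<le> k" "v \<in> bk i" by (auto simp: less_Suc_eq_le)
    show "v \<in> (\<Union>i<k. ?b i)"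
    proof (cases "i = k")
      case True
      then show ?thesis using i pk by (intro UN_I[of "par k"]) auto
    next
      case False
      then show ?thesis using i by (intro UN_I[of i]) auto
    qed
  qed (use pk in \<open>auto simp: less_Suc_eq split: if_splits\<close>)
  moreover have "\<exists>i<k. ord j \<in> ?b i \<and> ord (par j) \<in> ?b i" if "k \<le> j" "j < n" for j
  proof (cases "j = k")
    case True
    then show ?thesis using root[of k] root[of "par k"] pk by (intro exI[of _ "par k"]) auto
  next
    case False
    then have "Suc k \<le> j" using that by simp
    then obtain i where i: "i < Suc k" "ord j \<in> bk i" "ord (par j) \<in> bk i"
      using later \<open>j < n\<close> by blast
    show ?thesis
    proof (cases "i = k")
      case True
      then show ?thesis using i pk by (intro exI[of _ "par k"]) auto
    next
      case False
      then show ?thesis using i by (intro exI[of _ i]) auto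
    qed
  qed
  moreover have "?b i \<inter> ?b j = {}" if "i < k" "j < k" "i \<noteq> j" for i j
    using that pk dis[of _ i j] dis[of _ k i] dis[of _ k j] by (auto split: if_splits)
  ultimately show ?thesis
    using root un unfolding blocks_def by auto
qed

section \<open>Reasoning about programs\<close>

primrec nwrites :: "com \<Rightarrow> vname set" where
  "nwrites Skip = {}"
| "nwrites (NSet x i e) = {x}"
| "nwrites (RSet x i e) = {}"
| "nwrites (Seq P Q) = nwrites P \<union> nwrites Q"
| "nwrites (Cond p P Q) = nwrites P \<union> nwrites Q"
| "nwrites (While p P) = nwrites P"

primrec rwrites :: "com \<Rightarrow> vname set" where
  "rwrites Skip = {}"
| "rwrites (NSet x i e) = {}"
| "rwrites (RSet x i e) = {x}"
| "rwrites (Seq P Q) = rwrites P \<union> rwrites Q"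
| "rwrites (Cond p P Q) = rwrites P \<union> rwrites Q"
| "rwrites (While p P) = rwrites P"

text \<open>Tracked per array name and read off the program text, so invariants need to mention only
  arrays that the program assigns to.\<close>

definition frame :: "com \<Rightarrow> store \<Rightarrow> store \<Rightarrow> bool" where
  "frame c s s' \<longleftrightarrow>
    (\<forall>x. x \<notin> nwrites c \<longrightarrow> nmem s' x = nmem s x) \<and> (\<forall>x. x \<notin> rwrites c \<longrightarrow> rmem s' x = rmem s x)"

lemma nmem_nupd [simp]: "nmem (nupd x i k s) y = (if y = x then (nmem s x)(i := k) else nmem s y)"
  and rmem_nupd [simp]: "rmem (nupd x i k s) = rmem s"
  and rmem_rupd [simp]: "rmem (rupd x i r s) y = (if y = x then (rmem s x)(i := r) else rmem s y)"
  and nmem_rupd [simp]: "nmem (rupd x i r s) = nmem s"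
  by (auto simp: nupd_def rupd_def)

lemma frame_nmem: "frame c s s' \<Longrightarrow> x \<notin> nwrites c \<Longrightarrow> nmem s' x = nmem s x"
  by (auto simp: frame_def)

lemma frame_trans: "frame c s s' \<Longrightarrow> frame c s' s'' \<Longrightarrow> frame c s s''"
  by (simp add: frame_def)

lemma frame_sub:
  "frame c s s' \<Longrightarrow> nwrites c \<subseteq> nwrites d \<Longrightarrow> rwrites c \<subseteq> rwrites d \<Longrightarrow> frame d s s'"
  by (auto simp: frame_def subset_iff)

lemma exec_frame: "exec c s t s' \<Longrightarrow> frame c s s'"
  by (induction rule: exec.induct) (auto simp: frame_def)

text \<open>\<open>poly (steps c) N\<close> bounds the running time of \<open>c\<close> if every execution of a loop makes at most
  \<open>N\<close> iterations.\<close>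

primrec steps :: "com \<Rightarrow> nat poly" where
  "steps Skip = 1"
| "steps (NSet x i e) = 1"
| "steps (RSet x i e) = 1"
| "steps (Seq P Q) = steps P + steps Q"
| "steps (Cond p P Q) = 1 + steps P + steps Q"
| "steps (While p P) = 1 + [:0, 1:] * (1 + steps P)"

text \<open>Total correctness and the time bound in one predicate. The postcondition does not speak
  of time, as the bound depends on \<open>c\<close> and \<open>N\<close> alone.\<close>

definition runs :: "nat \<Rightarrow> com \<Rightarrow> store \<Rightarrow> (store \<Rightarrow> bool) \<Rightarrow> bool" where
  "runs N c s Q \<longleftrightarrow> (\<exists>t s'. exec c s t s' \<and> t \<le> poly (steps c) N \<and> Q s')"

lemma runsI: "exec c s t s' \<Longrightarrow> t \<le> poly (steps c) N \<Longrightarrow> Q s' \<Longrightarrow> runs N c s Q"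
  by (auto simp: runs_def)

lemma runs_conseq:
  "runs N c s Q \<Longrightarrow> (\<And>s'. frame c s s' \<Longrightarrow> Q s' \<Longrightarrow> R s') \<Longrightarrow> runs N c s R"
  unfolding runs_def using exec_frame by blast

lemma runs_Skip: "Q s \<Longrightarrow> runs N Skip s Q"
  by (rule runsI[OF exec.Skip]) auto

lemma runs_NSet: "Q (nupd x (nval i s) (nval e s) s) \<Longrightarrow> runs N (NSet x i e) s Q"
  by (rule runsI[OF exec.NSet]) auto

lemma runs_RSet: "Q (rupd x (nval i s) (rval e s) s) \<Longrightarrow> runs N (RSet x i e) s Q"
  by (rule runsI[OF exec.RSet]) auto

lemma runs_Seq:
  assumes "runs N c s R" "\<And>s'. frame c s s' \<Longrightarrow> R s' \<Longrightarrow> runs N d s' Q"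
  shows "runs N (Seq c d) s Q"
proof -
  obtain t s' where 1: "exec c s t s'" "t \<le> poly (steps c) N" "R s'"
    using assms(1) by (auto simp: runs_def)
  obtain t' s'' where 2: "exec d s' t' s''" "t' \<le> poly (steps d) N" "Q s''"
    using assms(2)[OF exec_frame[OF 1(1)] 1(3)] by (auto simp: runs_def)
  show ?thesis by (rule runsI[OF exec.Seq[OF 1(1) 2(1)]]) (use 1 2 in auto)
qed

lemma runs_NSet_Seq:
  "runs N d (nupd x (nval i s) (nval e s) s) Q \<Longrightarrow> runs N (Seq (NSet x i e) d) s Q"
  by (rule runs_Seq[OF runs_NSet[of "\<lambda>s'. s' = nupd x (nval i s) (nval e s) s"]]) auto

lemma runs_RSet_Seq:
  "runs N d (rupd x (nval i s) (rval e s) s) Q \<Longrightarrow> runs N (Seq (RSet x i e) d) s Q"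
  by (rule runs_Seq[OF runs_RSet[of "\<lambda>s'. s' = rupd x (nval i s) (rval e s) s"]]) auto

text \<open>\<open>steps\<close> charges for both branches, since a maximum of polynomials need not
  be a polynomial; whichever branch is taken is covered.\<close>

lemma runs_Cond:
  assumes "bval p s \<Longrightarrow> runs N c s Q" "\<not> bval p s \<Longrightarrow> runs N d s Q"
  shows "runs N (Cond p c d) s Q"
proof (cases "bval p s")
  case True
  then obtain t s' where "exec c s t s'" "t \<le> poly (steps c) N" "Q s'"
    using assms(1) by (auto simp: runs_def)
  then show ?thesis using True by (intro runsI[OF exec.CondTrue]) auto
next
  case False
  then obtain t s' where "exec d s t s'" "t \<le> poly (steps d) N" "Q s'"
    using assms(2) by (auto simp: runs_def)
  then show ?thesis using False by (intro runsI[OF exec.CondFalse]) auto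
qed

abbreviation scalar :: "vname \<Rightarrow> nexp" where
  "scalar x \<equiv> NGet x (NConst 0)"

text \<open>The bound \<open>e\<close> is evaluated again before every round, so proofs must show
  that the body keeps its value.\<close>

definition For :: "vname \<Rightarrow> nexp \<Rightarrow> com \<Rightarrow> com" where
  "For x e c = Seq (NSet x (NConst 0) (NConst 0))
    (While (NLess (scalar x) e) (Seq c (NSet x (NConst 0) (NAdd (scalar x) (NConst 1)))))"

lemma nwrites_For [simp]: "nwrites (For x e c) = insert x (nwrites c)"
  and rwrites_For [simp]: "rwrites (For x e c) = rwrites c"
  by (auto simp: For_def)

text \<open>The invariant must survive any change of the counter cell, which is reset before the
  loop and increased behind the body. Each round may also use the frame from the store before the
  loop, so unassigned arrays stay out of \<open>I\<close>.\<close>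

lemma runs_For:
  assumes L: "L \<le> N" and x: "x \<notin> nwrites c"
    and e: "\<And>s'. frame (For x e c) s s' \<Longrightarrow> nval e s' = L"
    and indep: "\<And>i k s'. I i s' \<Longrightarrow> I i (nupd x 0 k s')"
    and base: "I 0 s"
    and step: "\<And>i s'. i < L \<Longrightarrow> I i s' \<Longrightarrow> nmem s' x 0 = i \<Longrightarrow> frame (For x e c) s s' \<Longrightarrow>
      runs N c s' (I (Suc i))"
  shows "runs N (For x e c) s (I L)"
proof -
  let ?F = "For x e c" and ?S = "poly (steps c) N"
  let ?B = "Seq c (NSet x (NConst 0) (NAdd (scalar x) (NConst 1)))"
  let ?W = "While (NLess (scalar x) e) ?B"
  \<comment> \<open>Here \<open>j\<close> counts the rounds still to come. A round costs one test,
    the body and one increment; the leading 1 is the failing last test.\<close>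
  have loop: "\<exists>t s''. exec ?W s' t s'' \<and> t \<le> 1 + j * (?S + 2) \<and> I L s''"
    if "j \<le> L" "I (L - j) s'" "nmem s' x 0 = L - j" "frame ?F s s'" for j s'
    using that
  proof (induction j arbitrary: s')
    case 0
    then have "exec ?W s' 1 s'" using e by (intro exec.WhileFalse) simp
    then show ?case using 0 by auto
  next
    case (Suc j)
    let ?i = "L - Suc j"
    have i: "?i < L" "Suc ?i = L - j" using Suc.prems by auto
    obtain t s1 where 1: "exec c s' t s1" "t \<le> ?S" "I (Suc ?i) s1"
      using step[OF i(1) Suc.prems(2-4)] by (auto simp: runs_def)
    have x1: "nmem s1 x = nmem s' x" using exec_frame[OF 1(1)] x by (auto intro: frame_nmem)
    let ?s2 = "nupd x 0 (Suc ?i) s1"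
    have B: "exec ?B s' (t + 1) ?s2"
      using exec.Seq[OF 1(1) exec.NSet[of x "NConst 0" "NAdd (scalar x) (NConst 1)" s1]] x1 Suc.prems
      by simp
    have "frame ?F s' ?s2"
      using exec_frame[OF B] by (rule frame_sub) auto
    then have fr: "frame ?F s ?s2" by (rule frame_trans[OF Suc.prems(4)])
    obtain t' s'' where 2: "exec ?W ?s2 t' s''" "t' \<le> 1 + j * (?S + 2)" "I L s''"
      using Suc.IH[of ?s2] Suc.prems indep[OF 1(3)] fr i by auto
    have "bval (NLess (scalar x) e) s'" using e[OF Suc.prems(4)] Suc.prems i by simp
    then have "exec ?W s' (Suc (t + 1 + t')) s''" by (rule exec.WhileTrue[OF _ B 2(1)])
    moreover have "Suc (t + 1 + t') \<le> 1 + Suc j * (?S + 2)" using 1 2 by simp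
    ultimately show ?case using 2 by blast
  qed
  let ?s0 = "nupd x 0 0 s"
  have "frame ?F s ?s0" by (auto simp: frame_def)
  then obtain t s' where W: "exec ?W ?s0 t s'" "t \<le> 1 + L * (?S + 2)" "I L s'"
    using loop[of L ?s0] indep[OF base] by auto
  have E: "exec ?F s (1 + t) s'"
    unfolding For_def using exec.Seq[OF exec.NSet[of x "NConst 0" "NConst 0" s]] W by simp
  have "L * (?S + 2) \<le> N * (?S + 2)" using L by (rule mult_right_mono) simp
  then have "1 + t \<le> poly (steps ?F) N"
    using W(2) by (simp add: For_def algebra_simps)
  then show ?thesis using E W(3) by (intro runsI)
qed

text \<open>For loops that collect something over an index set: \<open>P\<close> is what has been
  processed so far. Since \<open>P\<close> is arbitrary at the start, the rule nests, and inner
  loops can start from whatever the outer ones have already done.\<close>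

lemma runs_For_union:
  assumes "L \<le> N" "x \<notin> nwrites c"
    and "\<And>s'. frame (For x e c) s s' \<Longrightarrow> nval e s' = L"
    and indep: "\<And>P k s'. J P s' \<Longrightarrow> J P (nupd x 0 k s')"
    and base: "J P s"
    and step: "\<And>i P s'. i < L \<Longrightarrow> J P s' \<Longrightarrow> nmem s' x 0 = i \<Longrightarrow> frame (For x e c) s s' \<Longrightarrow>
      runs N c s' (J (P \<union> S i))"
  shows "runs N (For x e c) s (J (P \<union> (\<Union>i<L. S i)))"
proof (rule runs_For[where I = "\<lambda>i. J (P \<union> (\<Union>j<i. S j))", OF assms(1-3)])
  fix i s' assume "i < L" "J (P \<union> (\<Union>j<i. S j)) s'" "nmem s' x 0 = i" "frame (For x e c) s s'"
  from step[OF this] show "runs N c s' (J (P \<union> (\<Union>j<Suc i. S j)))"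
    by (simp add: lessThan_Suc Un_ac)
qed (use indep base in auto)

text \<open>Repeated addition in place of multiplication. Index \<open>L\<close> itself is filled
  too: that last entry holds a product needed later.\<close>

definition Multiples :: "vname \<Rightarrow> nexp \<Rightarrow> nexp \<Rightarrow> com" where
  "Multiples d e l = Seq (NSet d (NConst 0) (NConst 0))
    (For ''i'' l (NSet d (NAdd (scalar ''i'') (NConst 1)) (NAdd (NGet d (scalar ''i'')) e)))"

lemma writes_Multiples [simp]:
  "nwrites (Multiples d e l) = {d, ''i''}" "rwrites (Multiples d e l) = {}"
  by (auto simp: Multiples_def)

lemma runs_Multiples:
  assumes L: "L \<le> N" and d: "d \<noteq> ''i''"
    and e: "\<And>s'. frame (Multiples d e l) s s' \<Longrightarrow> nval e s' = k"
    and l: "\<And>s'. frame (Multiples d e l) s s' \<Longrightarrow> nval l s' = L"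
  shows "runs N (Multiples d e l) s (\<lambda>s'. \<forall>x\<le>L. nmem s' d x = x * k)"
proof -
  let ?F = "For ''i'' l (NSet d (NAdd (scalar ''i'') (NConst 1)) (NAdd (NGet d (scalar ''i'')) e))"
  let ?s = "nupd d 0 0 s"
  have fr: "frame (Multiples d e l) s s'" if "frame ?F ?s s'" for s'
    using that by (auto simp: frame_def)
  have "runs N ?F ?s (\<lambda>s'. \<forall>x\<le>L. nmem s' d x = x * k)"
  proof (rule runs_For[where I = "\<lambda>i s'. \<forall>x\<le>i. nmem s' d x = x * k", OF L])
    fix i s' assume *: "\<forall>x\<le>i. nmem s' d x = x * k" "nmem s' ''i'' 0 = i" "frame ?F ?s s'"
    show "runs N (NSet d (NAdd (scalar ''i'') (NConst 1)) (NAdd (NGet d (scalar ''i'')) e)) s'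
      (\<lambda>s'. \<forall>x\<le>Suc i. nmem s' d x = x * k)"
      by (rule runs_NSet) (use * e[OF fr[OF *(3)]] in \<open>auto simp: le_Suc_eq\<close>)
  qed (use d l fr in auto)
  then show ?thesis unfolding Multiples_def by (intro runs_NSet_Seq) simp
qed

section \<open>The program\<close>

text \<open>The tables live in slots. The entry \<open>(m, q)\<close> of slot \<open>z\<close> sits in cell \<open>cell n z m q\<close> of the
  arrays \<open>val\<close> and \<open>cst\<close>; its node set is the bit vector that starts in cell \<open>cell n z m q * base n\<close>
  of the array \<open>bit\<close>. The machine cannot multiply, so it finds these addresses in the
  arrays \<open>b1\<close>, \<open>b2\<close>, \<open>b3\<close> of multiples of the powers of \<open>base n\<close>.\<close>

definition base :: "nat \<Rightarrow> nat" where
  "base n = Suc (n * n)"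

definition cell :: "nat \<Rightarrow> nat \<Rightarrow> nat \<Rightarrow> nat \<Rightarrow> nat" where
  "cell n z m q = (z * base n + m) * base n + q"

definition cellE :: "nexp \<Rightarrow> nexp \<Rightarrow> nexp \<Rightarrow> nexp" where
  "cellE z m q = NAdd (NAdd (NGet ''b2'' z) (NGet ''b1'' m)) q"

definition bitE :: "nexp \<Rightarrow> nexp \<Rightarrow> nexp \<Rightarrow> nexp \<Rightarrow> nexp" where
  "bitE z m q u = NAdd (NAdd (NAdd (NGet ''b3'' z) (NGet ''b2'' m)) (NGet ''b1'' q)) u"

text \<open>A zero in \<open>val\<close> means that there is no entry, so zero-filled memory already
  holds empty tables in all slots.\<close>

definition tbl :: "nat \<Rightarrow> store \<Rightarrow> nat \<Rightarrow> table" where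
  "tbl n s z m q =
    (if nmem s ''val'' (cell n z m q) = 0 then None
     else Some (rmem s ''cst'' (cell n z m q),
       {u. u < n \<and> nmem s ''bit'' (cell n z m q * base n + u) \<noteq> 0}))"

text \<open>The input together with the address tables. Nothing after the set-up phase writes to
  these arrays, so the predicate is carried along by \<open>ready_frame\<close>.\<close>

definition ready :: "nat \<Rightarrow> nat set set \<Rightarrow> (nat \<Rightarrow> real) \<Rightarrow> real \<Rightarrow> store \<Rightarrow> bool" where
  "ready n E c b s \<longleftrightarrow> nmem s ''n'' 0 = n \<and> (\<forall>x\<le>n. nmem s ''nt'' x = x * n) \<and>
    nmem s ''B'' 0 = base n \<and> (\<forall>x\<le>base n. nmem s ''b1'' x = x * base n) \<and>
    (\<forall>x\<le>base n. nmem s ''b2'' x = x * (base n * base n)) \<and>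
    (\<forall>x\<le>base n. nmem s ''b3'' x = x * (base n * (base n * base n))) \<and>
    (\<forall>u<n. \<forall>v<n. nmem s ''adj'' (u * n + v) \<noteq> 0 \<longleftrightarrow> {u, v} \<in> E) \<and>
    (\<forall>v<n. rmem s ''cost'' v = c v) \<and> rmem s ''budget'' 0 = b"

definition input_nats :: "vname set" where
  "input_nats = {''n'', ''nt'', ''B'', ''b1'', ''b2'', ''b3'', ''adj''}"

definition input_reals :: "vname set" where
  "input_reals = {''cost'', ''budget''}"

lemma ready_frame:
  "frame C s s' \<Longrightarrow> ready n E c b s \<Longrightarrow> nwrites C \<inter> input_nats = {} \<Longrightarrow>
    rwrites C \<inter> input_reals = {} \<Longrightarrow> ready n E c b s'"
  by (simp add: ready_def input_nats_def input_reals_def frame_def)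

lemma ready_nupd [simp]: "ready n E c b s \<Longrightarrow> x \<notin> input_nats \<Longrightarrow> ready n E c b (nupd x i k s)"
  and ready_rupd [simp]: "ready n E c b s \<Longrightarrow> x \<notin> input_reals \<Longrightarrow> ready n E c b (rupd x i r s)"
  by (rule ready_frame[of "NSet x (NConst i) (NConst k)" s], auto simp: frame_def)
    (rule ready_frame[of "RSet x (NConst i) e" s for e], auto simp: frame_def)

lemma tbl_nupd [simp]: "x \<noteq> ''val'' \<Longrightarrow> x \<noteq> ''bit'' \<Longrightarrow> tbl n (nupd x i k s) = tbl n s"
  and tbl_rupd [simp]: "x \<noteq> ''cst'' \<Longrightarrow> tbl n (rupd x i r s) = tbl n s"
  by (auto simp: tbl_def fun_eq_iff)

lemma tbl_frame:
  "frame C s s' \<Longrightarrow> ''val'' \<notin> nwrites C \<Longrightarrow> ''bit'' \<notin> nwrites C \<Longrightarrow> ''cst'' \<notin> rwrites C \<Longrightarrow>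
    tbl n s' = tbl n s"
  by (auto simp: tbl_def fun_eq_iff frame_def)

lemma nval_cellE:
  assumes "ready n E c b s" "nval z s \<le> base n" "nval m s \<le> base n"
  shows "nval (cellE z m q) s = cell n (nval z s) (nval m s) (nval q s)"
  using assms by (simp add: ready_def cellE_def cell_def algebra_simps)

lemma nval_bitE:
  assumes "ready n E c b s" "nval z s \<le> base n" "nval m s \<le> base n" "nval q s \<le> base n"
  shows "nval (bitE z m q u) s = cell n (nval z s) (nval m s) (nval q s) * base n + nval u s"
  using assms by (simp add: ready_def bitE_def cell_def algebra_simps)

lemma digits_eq:
  fixes a b :: nat
  assumes "x < B" "y < B"
  shows "a * B + x = b * B + y \<longleftrightarrow> a = b \<and> x = y"
proof
  assume eq: "a * B + x = b * B + y"
  have "(a * B + x) div B = a" "(b * B + y) div B = b" using assms by auto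
  then show "a = b \<and> x = y" using eq by auto
qed simp

text \<open>An address is a number in base \<open>base n\<close> with leading digit \<open>z\<close>
  followed by \<open>m\<close> and \<open>q\<close>.\<close>

lemma cell_eq:
  "m < base n \<Longrightarrow> q < base n \<Longrightarrow> m' < base n \<Longrightarrow> q' < base n \<Longrightarrow>
    cell n z m q = cell n z' m' q' \<longleftrightarrow> z = z' \<and> m = m' \<and> q = q'"
  by (simp add: cell_def digits_eq)

lemma base_bounds: "n < base n" "n \<le> base n" "0 < base n"
  by (cases n; simp add: base_def)+

section \<open>Storing one candidate\<close>

text \<open>Offers the node set marked in \<open>d\<close>, of cost \<open>r\<close>, to the entry \<open>(m, q)\<close> of slot \<open>z\<close>.\<close>

definition Put :: com where
  "Put = Cond (BNot (BAnd
      (NLess (NConst 0) (NGet ''val'' (cellE (scalar ''z'') (scalar ''m'') (scalar ''q''))))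
      (BNot (RLess (RGet ''r'' (NConst 0))
        (RGet ''cst'' (cellE (scalar ''z'') (scalar ''m'') (scalar ''q'')))))))
    (Seq (NSet ''val'' (cellE (scalar ''z'') (scalar ''m'') (scalar ''q'')) (NConst 1))
    (Seq (RSet ''cst'' (cellE (scalar ''z'') (scalar ''m'') (scalar ''q'')) (RGet ''r'' (NConst 0)))
      (For ''u'' (scalar ''n'')
        (NSet ''bit'' (bitE (scalar ''z'') (scalar ''m'') (scalar ''q'') (scalar ''u''))
          (NGet ''d'' (scalar ''u''))))))
    Skip"

lemma writes_Put [simp]: "nwrites Put = {''val'', ''u'', ''bit''}" "rwrites Put = {''cst''}"
  by (auto simp: Put_def)

text \<open>The effect is the update that \<open>represents_insert\<close> expects. It is stated for
  indices below \<open>base n\<close> only, where distinct entries have distinct cells.\<close>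

lemma runs_Put:
  assumes rdy: "ready n E c b s" and z: "nmem s ''z'' 0 = z" "z \<le> base n"
    and m: "nmem s ''m'' 0 = m" "m < base n" and q: "nmem s ''q'' 0 = q" "q < base n"
    and r: "rmem s ''r'' 0 = r" and D: "D = {u. u < n \<and> nmem s ''d'' u \<noteq> 0}"
  shows "runs (base n) Put s (\<lambda>s'. \<forall>z' m' q'. m' < base n \<longrightarrow> q' < base n \<longrightarrow> tbl n s' z' m' q' =
    (if z' = z \<and> m' = m \<and> q' = q \<and> improves (tbl n s z) m q r then Some (r, D)
     else tbl n s z' m' q'))" (is "runs _ _ _ ?Q")
proof -
  let ?c = "cell n z m q" and ?B = "base n"
  have c: "nval (cellE (scalar ''z'') (scalar ''m'') (scalar ''q'')) s = ?c"
    using nval_cellE[OF rdy] z m q by simp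
  let ?s1 = "nupd ''val'' ?c 1 s"
  have c1: "nval (cellE (scalar ''z'') (scalar ''m'') (scalar ''q'')) ?s1 = ?c"
    using nval_cellE[of n E c b ?s1] rdy z m q by (simp add: input_nats_def)
  let ?s2 = "rupd ''cst'' ?c r ?s1"
  have r2: "ready n E c b ?s2" using rdy by (simp add: input_nats_def input_reals_def)
  have imp: "bval (BNot (BAnd
      (NLess (NConst 0) (NGet ''val'' (cellE (scalar ''z'') (scalar ''m'') (scalar ''q''))))
      (BNot (RLess (RGet ''r'' (NConst 0))
        (RGet ''cst'' (cellE (scalar ''z'') (scalar ''m'') (scalar ''q''))))))) s
    \<longleftrightarrow> improves (tbl n s z) m q r"
    using r by (auto simp: c improves_def tbl_def)
  let ?W = "NSet ''bit'' (bitE (scalar ''z'') (scalar ''m'') (scalar ''q'') (scalar ''u''))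
          (NGet ''d'' (scalar ''u''))"
  let ?L = "For ''u'' (scalar ''n'') ?W"
  \<comment> \<open>Stated for every address: exactly the first \<open>i\<close> cells of the target
    bit vector have been overwritten.\<close>
  let ?I = "\<lambda>i s'. \<forall>a. nmem s' ''bit'' a =
    (if ?c * ?B \<le> a \<and> a < ?c * ?B + i then nmem s ''d'' (a - ?c * ?B) else nmem s ''bit'' a)"
  have loop: "runs ?B ?L ?s2 (?I n)"
  proof (rule runs_For[where I = ?I])
    fix i s' assume *: "?I i s'" "nmem s' ''u'' 0 = i" "frame ?L ?s2 s'" "i < n"
    have "ready n E c b s'"
      using *(3) r2 by (rule ready_frame) (auto simp: input_nats_def input_reals_def)
    then have a: "nval (bitE (scalar ''z'') (scalar ''m'') (scalar ''q'') (scalar ''u'')) s'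
        = ?c * ?B + i"
      using nval_bitE[of n E c b s'] z m q * by (simp add: frame_def)
    have d: "nmem s' ''d'' = nmem s ''d''" using *(3) by (simp add: frame_def)
    show "runs ?B ?W s' (?I (Suc i))"
      by (rule runs_NSet) (use * in \<open>auto simp: a d\<close>)
  next
    fix s' assume "frame ?L ?s2 s'"
    then show "nval (scalar ''n'') s' = n" using rdy by (simp add: frame_def ready_def)
  qed (auto simp: base_bounds)
  have fin: "?Q s'" if I: "?I n s'" and fr: "frame ?L ?s2 s'"
    and im: "improves (tbl n s z) m q r" for s'
  proof (intro allI impI)
    fix z' m' q' assume mq: "m' < ?B" "q' < ?B"
    have v: "nmem s' ''val'' = (nmem s ''val'')(?c := 1)" "rmem s' ''cst'' = (rmem s ''cst'')(?c := r)"
      using fr by (simp_all add: frame_def)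
    show "tbl n s' z' m' q' =
      (if z' = z \<and> m' = m \<and> q' = q \<and> improves (tbl n s z) m q r then Some (r, D)
       else tbl n s z' m' q')"
    proof (cases "z' = z \<and> m' = m \<and> q' = q")
      case True
      have "nmem s' ''bit'' (?c * ?B + u) = nmem s ''d'' u" if "u < n" for u
        using I that by simp
      then show ?thesis using True v im D by (auto simp: tbl_def)
    next
      case False
      then have ne: "cell n z' m' q' \<noteq> ?c" using cell_eq[OF mq m(2) q(2)] by auto
      have "nmem s' ''bit'' (cell n z' m' q' * ?B + u) = nmem s ''bit'' (cell n z' m' q' * ?B + u)"
        if u: "u < n" for u
      proof -
        \<comment> \<open>Bit vectors of different cells do not overlap, because the offset inside a
          vector is below \<open>n < base n\<close>.\<close>
        have out: "\<not> (?c * ?B \<le> cell n z' m' q' * ?B + u \<and> cell n z' m' q' * ?B + u < ?c * ?B + n)"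
        proof
          assume *: "?c * ?B \<le> cell n z' m' q' * ?B + u \<and> cell n z' m' q' * ?B + u < ?c * ?B + n"
          then obtain w where w: "cell n z' m' q' * ?B + u = ?c * ?B + w" using le_Suc_ex by blast
          then have "w < n" using * by simp
          then show False using w ne u base_bounds(1)[of n] digits_eq[of u ?B w] by simp
        qed
        show ?thesis by (subst I[rule_format]) (rule if_not_P[OF out])
      qed
      then show ?thesis using False v ne by (auto simp: tbl_def)
    qed
  qed
  show ?thesis unfolding Put_def
  proof (rule runs_Cond)
    assume "bval (BNot (BAnd
      (NLess (NConst 0) (NGet ''val'' (cellE (scalar ''z'') (scalar ''m'') (scalar ''q''))))
      (BNot (RLess (RGet ''r'' (NConst 0))
        (RGet ''cst'' (cellE (scalar ''z'') (scalar ''m'') (scalar ''q''))))))) s"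
    then have im: "improves (tbl n s z) m q r" by (simp only: imp)
    have "runs ?B ?L ?s2 ?Q"
      using loop by (rule runs_conseq) (rule fin[OF _ _ im])
    then show "runs ?B (Seq (NSet ''val'' (cellE (scalar ''z'') (scalar ''m'') (scalar ''q'')) (NConst 1))
      (Seq (RSet ''cst'' (cellE (scalar ''z'') (scalar ''m'') (scalar ''q'')) (RGet ''r'' (NConst 0)))
        ?L)) s ?Q"
      by (intro runs_NSet_Seq runs_RSet_Seq) (simp only: c c1 r nval.simps rval.simps rmem_nupd)
  next
    assume "\<not> bval (BNot (BAnd
      (NLess (NConst 0) (NGet ''val'' (cellE (scalar ''z'') (scalar ''m'') (scalar ''q''))))
      (BNot (RLess (RGet ''r'' (NConst 0))
        (RGet ''cst'' (cellE (scalar ''z'') (scalar ''m'') (scalar ''q''))))))) s"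
    then have "\<not> improves (tbl n s z) m q r" by (simp only: imp not_False_eq_True)
    then show "runs ?B Skip s ?Q" by (simp add: runs_Skip)
  qed
qed

section \<open>Address tables\<close>

definition Powers :: com where
  "Powers =
    Seq (Multiples ''nt'' (scalar ''n'') (scalar ''n''))
    (Seq (NSet ''B'' (NConst 0) (NAdd (NGet ''nt'' (scalar ''n'')) (NConst 1)))
    (Seq (Multiples ''b1'' (scalar ''B'') (scalar ''B''))
    (Seq (Multiples ''b2'' (NGet ''b1'' (scalar ''B'')) (scalar ''B''))
      (Multiples ''b3'' (NGet ''b2'' (scalar ''B'')) (scalar ''B'')))))"

lemma writes_Powers [simp]:
  "nwrites Powers = {''nt'', ''i'', ''B'', ''b1'', ''b2'', ''b3''}" "rwrites Powers = {}"
  by (auto simp: Powers_def)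

text \<open>Each stride is found in the table before: \<open>n * n\<close> at index \<open>n\<close>
  of \<open>nt\<close>, and the square and the cube of \<open>base n\<close> at index
  \<open>base n\<close> of \<open>b1\<close> and \<open>b2\<close>.\<close>

lemma runs_Powers:
  assumes n: "nmem s ''n'' 0 = n"
    and adj: "\<And>u v. u < n \<Longrightarrow> v < n \<Longrightarrow> nmem s ''adj'' (u * n + v) \<noteq> 0 \<longleftrightarrow> {u, v} \<in> E"
    and cost: "\<And>v. v < n \<Longrightarrow> rmem s ''cost'' v = c v" and budget: "rmem s ''budget'' 0 = b"
  shows "runs (base n) Powers s (ready n E c b)"
proof -
  let ?B = "base n"
  have 1: "runs ?B (Multiples ''nt'' (scalar ''n'') (scalar ''n'')) s
      (\<lambda>s'. \<forall>x\<le>n. nmem s' ''nt'' x = x * n)"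
    by (rule runs_Multiples) (use n in \<open>auto simp: frame_def base_bounds\<close>)
  have 2: "runs ?B (Multiples ''b1'' (scalar ''B'') (scalar ''B'')) s'
      (\<lambda>s'. \<forall>x\<le>?B. nmem s' ''b1'' x = x * ?B)" if "nmem s' ''B'' 0 = ?B" for s'
    by (rule runs_Multiples) (use that in \<open>auto simp: frame_def\<close>)
  have 3: "runs ?B (Multiples ''b2'' (NGet ''b1'' (scalar ''B'')) (scalar ''B'')) s'
      (\<lambda>s'. \<forall>x\<le>?B. nmem s' ''b2'' x = x * (?B * ?B))"
    if "nmem s' ''B'' 0 = ?B" "\<forall>x\<le>?B. nmem s' ''b1'' x = x * ?B" for s'
    by (rule runs_Multiples) (use that in \<open>auto simp: frame_def\<close>)
  have 4: "runs ?B (Multiples ''b3'' (NGet ''b2'' (scalar ''B'')) (scalar ''B'')) s'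
      (\<lambda>s'. \<forall>x\<le>?B. nmem s' ''b3'' x = x * (?B * (?B * ?B)))"
    if "nmem s' ''B'' 0 = ?B" "\<forall>x\<le>?B. nmem s' ''b2'' x = x * (?B * ?B)" for s'
    by (rule runs_Multiples) (use that in \<open>auto simp: frame_def\<close>)
  show ?thesis unfolding Powers_def
  proof (rule runs_Seq[OF 1], rule runs_NSet_Seq)
    fix s1 assume s1: "frame (Multiples ''nt'' (scalar ''n'') (scalar ''n'')) s s1"
      "\<forall>x\<le>n. nmem s1 ''nt'' x = x * n"
    let ?s2 = "nupd ''B'' (nval (NConst 0) s1) (nval (NAdd (NGet ''nt'' (scalar ''n'')) (NConst 1)) s1) s1"
    have n1: "nmem s1 ''n'' 0 = n" using s1 n by (simp add: frame_def)
    have B2: "nmem ?s2 ''B'' 0 = ?B" using n1 s1(2) by (simp add: base_def)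
    show "runs ?B (Seq (Multiples ''b1'' (scalar ''B'') (scalar ''B''))
      (Seq (Multiples ''b2'' (NGet ''b1'' (scalar ''B'')) (scalar ''B''))
        (Multiples ''b3'' (NGet ''b2'' (scalar ''B'')) (scalar ''B'')))) ?s2 (ready n E c b)"
    proof (rule runs_Seq[OF 2[OF B2]])
      fix s3 assume s3: "frame (Multiples ''b1'' (scalar ''B'') (scalar ''B'')) ?s2 s3"
        "\<forall>x\<le>?B. nmem s3 ''b1'' x = x * ?B"
      have B3: "nmem s3 ''B'' 0 = ?B" using s3 B2 by (simp add: frame_def)
      show "runs ?B (Seq (Multiples ''b2'' (NGet ''b1'' (scalar ''B'')) (scalar ''B''))
        (Multiples ''b3'' (NGet ''b2'' (scalar ''B'')) (scalar ''B''))) s3 (ready n E c b)"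
      proof (rule runs_Seq[OF 3[OF B3 s3(2)]])
        fix s4 assume s4: "frame (Multiples ''b2'' (NGet ''b1'' (scalar ''B'')) (scalar ''B'')) s3 s4"
          "\<forall>x\<le>?B. nmem s4 ''b2'' x = x * (?B * ?B)"
        have B4: "nmem s4 ''B'' 0 = ?B" using s4 B3 by (simp add: frame_def)
        show "runs ?B (Multiples ''b3'' (NGet ''b2'' (scalar ''B'')) (scalar ''B'')) s4 (ready n E c b)"
        proof (rule runs_conseq[OF 4[OF B4 s4(2)]])
          fix s5 assume s5: "frame (Multiples ''b3'' (NGet ''b2'' (scalar ''B'')) (scalar ''B'')) s4 s5"
            "\<forall>x\<le>?B. nmem s5 ''b3'' x = x * (?B * (?B * ?B))"
          have "nmem s5 ''n'' = nmem s1 ''n''" "nmem s5 ''nt'' = nmem s1 ''nt''"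
            "nmem s5 ''B'' = nmem s4 ''B''" "nmem s5 ''b1'' = nmem s3 ''b1''"
            "nmem s5 ''b2'' = nmem s4 ''b2''" "nmem s5 ''adj'' = nmem s ''adj''"
            "rmem s5 = rmem s"
            using s1(1) s3(1) s4(1) s5(1) by (simp_all add: frame_def fun_eq_iff)
          then show "ready n E c b s5"
            unfolding ready_def using n1 s1(2) B4 s3(2) s4(2) s5(2) adj cost budget by simp
        qed
      qed
    qed
  qed
qed

section \<open>Graph search\<close>

definition Search :: com where
  "Search = For ''i'' (NAdd (scalar ''k'') (NConst 1)) (For ''j'' (scalar ''n'')
    (Cond (BAnd (BNot (NLess (NConst 0) (NGet ''vis'' (scalar ''j''))))
        (NLess (NConst 0) (NGet ''adj''
          (NAdd (NGet ''nt'' (NGet ''ord'' (scalar ''i''))) (scalar ''j'')))))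
      (Seq (NSet ''ord'' (NAdd (scalar ''k'') (NConst 1)) (scalar ''j''))
        (NSet ''par'' (NAdd (scalar ''k'') (NConst 1)) (scalar ''i'')))
      Skip))"

lemma writes_Search [simp]:
  "nwrites Search = {''i'', ''j'', ''ord'', ''par''}" "rwrites Search = {}"
  by (auto simp: Search_def)

text \<open>The scan does not stop at a hit; later hits overwrite position \<open>k + 1\<close>.
  This is harmless, since the test reads only \<open>vis\<close>, \<open>adj\<close> and positions
  up to \<open>k\<close>, and any hit will do.\<close>

lemma runs_Search:
  assumes rdy: "ready n E c b s" and k: "nmem s ''k'' 0 = k" "Suc k < n"
    and ord: "\<And>i. i \<le> k \<Longrightarrow> nmem s ''ord'' i < n"
    and ex: "\<exists>i\<le>k. \<exists>v<n. nmem s ''vis'' v = 0 \<and> {nmem s ''ord'' i, v} \<in> E"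
  shows "runs (base n) Search s (\<lambda>s'.
    (\<forall>x\<noteq>Suc k. nmem s' ''ord'' x = nmem s ''ord'' x \<and> nmem s' ''par'' x = nmem s ''par'' x) \<and>
    nmem s' ''par'' (Suc k) \<le> k \<and> nmem s' ''ord'' (Suc k) < n \<and>
    nmem s ''vis'' (nmem s' ''ord'' (Suc k)) = 0 \<and>
    {nmem s ''ord'' (nmem s' ''par'' (Suc k)), nmem s' ''ord'' (Suc k)} \<in> E)"
proof -
  let ?good = "\<lambda>i j. i \<le> k \<and> j < n \<and> nmem s ''vis'' j = 0 \<and> {nmem s ''ord'' i, j} \<in> E"
  \<comment> \<open>Once the scanned pairs \<open>P\<close> include a good one, position
    \<open>k + 1\<close> holds a good pair.\<close>
  let ?J = "\<lambda>P s'.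
    (\<forall>x\<noteq>Suc k. nmem s' ''ord'' x = nmem s ''ord'' x \<and> nmem s' ''par'' x = nmem s ''par'' x) \<and>
    ((\<exists>i j. (i, j) \<in> P \<and> ?good i j) \<longrightarrow> ?good (nmem s' ''par'' (Suc k)) (nmem s' ''ord'' (Suc k)))"
  let ?C = "Cond (BAnd (BNot (NLess (NConst 0) (NGet ''vis'' (scalar ''j''))))
        (NLess (NConst 0) (NGet ''adj''
          (NAdd (NGet ''nt'' (NGet ''ord'' (scalar ''i''))) (scalar ''j'')))))
      (Seq (NSet ''ord'' (NAdd (scalar ''k'') (NConst 1)) (scalar ''j''))
        (NSet ''par'' (NAdd (scalar ''k'') (NConst 1)) (scalar ''i'')))
      Skip"
  let ?F = "For ''j'' (scalar ''n'') ?C"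
  have n: "nmem s ''n'' 0 = n" using rdy by (simp add: ready_def)
  have "runs (base n) Search s (?J ({} \<union> (\<Union>i<Suc k. \<Union>j<n. {(i, j)})))"
    unfolding Search_def
  proof (rule runs_For_union[where J = ?J])
    fix i P s1 assume i: "i < Suc k" and J1: "?J P s1" and i1: "nmem s1 ''i'' 0 = i"
      and f1: "frame (For ''i'' (NAdd (scalar ''k'') (NConst 1)) ?F) s s1"
    show "runs (base n) ?F s1 (?J (P \<union> (\<Union>j<n. {(i, j)})))"
    proof (rule runs_For_union[where J = ?J])
      fix j P s2 assume j: "j < n" and J2: "?J P s2" and j2: "nmem s2 ''j'' 0 = j"
        and f2: "frame ?F s1 s2"
      have eqs: "nmem s2 ''i'' 0 = i" "nmem s2 ''k'' 0 = k" "nmem s2 ''vis'' = nmem s ''vis''"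
        "nmem s2 ''adj'' = nmem s ''adj''" "nmem s2 ''nt'' = nmem s ''nt''"
        using f1 f2 i1 k by (simp_all add: frame_def)
      have "nmem s2 ''ord'' i = nmem s ''ord'' i" "nmem s ''ord'' i < n" using J2 i ord by auto
      then have test: "bval (BAnd (BNot (NLess (NConst 0) (NGet ''vis'' (scalar ''j''))))
        (NLess (NConst 0) (NGet ''adj''
          (NAdd (NGet ''nt'' (NGet ''ord'' (scalar ''i''))) (scalar ''j''))))) s2 \<longleftrightarrow> ?good i j"
        using rdy i j by (auto simp: eqs j2 ready_def)
      show "runs (base n) ?C s2 (?J (P \<union> {(i, j)}))"
      proof (rule runs_Cond; simp only: test)
        assume "?good i j"
        then show "runs (base n) (Seq (NSet ''ord'' (NAdd (scalar ''k'') (NConst 1)) (scalar ''j''))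
          (NSet ''par'' (NAdd (scalar ''k'') (NConst 1)) (scalar ''i''))) s2 (?J (P \<union> {(i, j)}))"
          using J2 by (intro runs_NSet_Seq runs_NSet) (simp add: eqs j2)
      next
        assume "\<not> ?good i j"
        then show "runs (base n) Skip s2 (?J (P \<union> {(i, j)}))"
          using J2 by (intro runs_Skip) blast
      qed
    next
      fix s' assume "frame ?F s1 s'"
      then show "nval (scalar ''n'') s' = n" using f1 n by (simp add: frame_def)
    qed (use J1 in \<open>auto simp: base_bounds\<close>)
  next
    fix s' assume "frame (For ''i'' (NAdd (scalar ''k'') (NConst 1)) ?F) s s'"
    then show "nval (NAdd (scalar ''k'') (NConst 1)) s' = Suc k" using k by (simp add: frame_def)
  next
    show "Suc k \<le> base n" using k(2) base_bounds(1)[of n] by simp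
  qed auto
  then show ?thesis
  proof (rule runs_conseq)
    fix s' assume "?J ({} \<union> (\<Union>i<Suc k. \<Union>j<n. {(i, j)})) s'"
    moreover have "\<exists>i j. (i, j) \<in> {} \<union> (\<Union>i<Suc k. \<Union>j<n. {(i, j)}) \<and> ?good i j"
      using ex by (auto simp: less_Suc_eq_le)
    ultimately show "(\<forall>x\<noteq>Suc k. nmem s' ''ord'' x = nmem s ''ord'' x \<and>
        nmem s' ''par'' x = nmem s ''par'' x) \<and>
      nmem s' ''par'' (Suc k) \<le> k \<and> nmem s' ''ord'' (Suc k) < n \<and>
      nmem s ''vis'' (nmem s' ''ord'' (Suc k)) = 0 \<and>
      {nmem s ''ord'' (nmem s' ''par'' (Suc k)), nmem s' ''ord'' (Suc k)} \<in> E"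
      by blast
  qed
qed

text \<open>Node 0 serves as root. As memory starts at zero, \<open>ord\<close> already holds it at
  position 0, and only its visited mark has to be set.\<close>

definition Order :: com where
  "Order = Seq (NSet ''vis'' (NConst 0) (NConst 1))
    (For ''k'' (NSub (scalar ''n'') (NConst 1))
      (Seq Search (NSet ''vis'' (NGet ''ord'' (NAdd (scalar ''k'') (NConst 1))) (NConst 1))))"

lemma writes_Order [simp]:
  "nwrites Order = {''vis'', ''k'', ''i'', ''j'', ''ord'', ''par''}" "rwrites Order = {}"
  by (auto simp: Order_def)

lemma search_order_Suc:
  assumes so: "search_order E n ord par K"
    and same: "\<And>i. i < K \<Longrightarrow> ord' i = ord i \<and> par' i = par i"
    and new: "par' K < K" "ord' K < n" "ord' K \<notin> ord ` {..<K}" "{ord (par' K), ord' K} \<in> E"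
  shows "search_order E n ord' par' (Suc K)"
proof -
  have img: "ord' ` {..<K} = ord ` {..<K}" using same by (intro image_cong) auto
  have "inj_on ord' {..<K} \<longleftrightarrow> inj_on ord {..<K}" using same by (intro inj_on_cong) auto
  then have "inj_on ord' {..<Suc K}"
    using so new img by (simp add: search_order_def lessThan_Suc)
  moreover have "ord' ` {..<Suc K} \<subseteq> {..<n}"
    using so new img by (simp add: search_order_def lessThan_Suc)
  moreover have "par' k < k \<and> {ord' (par' k), ord' k} \<in> E" if "0 < k" "k < Suc K" for k
  proof (cases "k = K")
    case True
    then show ?thesis using new same by simp
  next
    case False
    then have "k < K" using that by simp
    then have "par k < k \<and> {ord (par k), ord k} \<in> E" using so that by (simp add: search_order_def)
    then show ?thesis using same[of k] same[of "par k"] \<open>k < K\<close> by simp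
  qed
  ultimately show ?thesis by (simp add: search_order_def)
qed

lemma runs_Order:
  assumes rdy: "ready n E c b s" and n: "0 < n" and conn: "connected_graph {..<n} E"
    and ord0: "nmem s ''ord'' 0 = 0" and vis: "\<And>v. nmem s ''vis'' v = 0"
  shows "runs (base n) Order s (\<lambda>s'. search_order E n (nmem s' ''ord'') (nmem s' ''par'') n)"
proof -
  let ?s = "nupd ''vis'' 0 1 s"
  let ?C = "Seq Search (NSet ''vis'' (NGet ''ord'' (NAdd (scalar ''k'') (NConst 1))) (NConst 1))"
  let ?F = "For ''k'' (NSub (scalar ''n'') (NConst 1)) ?C"
  \<comment> \<open>After \<open>k\<close> rounds there are \<open>k + 1\<close> discovered nodes,
    since the root is known from the start; hence \<open>n - 1\<close> rounds.\<close>
  let ?I = "\<lambda>k s'. search_order E n (nmem s' ''ord'') (nmem s' ''par'') (Suc k) \<and>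
    (\<forall>v<n. nmem s' ''vis'' v \<noteq> 0 \<longleftrightarrow> v \<in> nmem s' ''ord'' ` {..<Suc k})"
  have rdy': "ready n E c b ?s" using rdy by (simp add: input_nats_def)
  have "runs (base n) ?F ?s (?I (n - 1))"
  proof (rule runs_For[where I = ?I])
    fix k s1 assume k: "k < n - 1" and I: "?I k s1" and k1: "nmem s1 ''k'' 0 = k"
      and f1: "frame ?F ?s s1"
    have r1: "ready n E c b s1"
      using f1 rdy' by (rule ready_frame) (auto simp: input_nats_def input_reals_def)
    have ord1: "nmem s1 ''ord'' i < n" if "i \<le> k" for i
      using I that by (simp add: search_order_def image_subset_iff)
    have kn: "Suc k < n" using k by simp
    obtain i v where "i < Suc k" "v < n" "v \<notin> nmem s1 ''ord'' ` {..<Suc k}" "{nmem s1 ''ord'' i, v} \<in> E"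
      using search_order_extend[OF conn conjunct1[OF I] _ kn] by blast
    then have ex: "\<exists>i\<le>k. \<exists>v<n. nmem s1 ''vis'' v = 0 \<and> {nmem s1 ''ord'' i, v} \<in> E"
      using I less_Suc_eq_le by blast
    show "runs (base n) ?C s1 (?I (Suc k))"
    proof (rule runs_Seq[OF runs_Search[OF r1 k1 kn ord1 ex]], assumption)
      fix s2 assume f2: "frame Search s1 s2"
        and s2: "(\<forall>x\<noteq>Suc k. nmem s2 ''ord'' x = nmem s1 ''ord'' x \<and>
          nmem s2 ''par'' x = nmem s1 ''par'' x) \<and>
          nmem s2 ''par'' (Suc k) \<le> k \<and> nmem s2 ''ord'' (Suc k) < n \<and>
          nmem s1 ''vis'' (nmem s2 ''ord'' (Suc k)) = 0 \<and>
          {nmem s1 ''ord'' (nmem s2 ''par'' (Suc k)), nmem s2 ''ord'' (Suc k)} \<in> E"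
      have eqs: "nmem s2 ''vis'' = nmem s1 ''vis''" "nmem s2 ''k'' 0 = k"
        using f2 k1 by (simp_all add: frame_def)
      have so: "search_order E n (nmem s2 ''ord'') (nmem s2 ''par'') (Suc (Suc k))"
        by (rule search_order_Suc[of E n "nmem s1 ''ord''" "nmem s1 ''par''"]) (use I s2 in auto)
      have img: "nmem s2 ''ord'' ` {..<Suc (Suc k)} =
        insert (nmem s2 ''ord'' (Suc k)) (nmem s1 ''ord'' ` {..<Suc k})"
      proof -
        have "nmem s2 ''ord'' ` {..<Suc k} = nmem s1 ''ord'' ` {..<Suc k}"
          using s2 by (intro image_cong) auto
        then show ?thesis by (simp add: lessThan_Suc[of "Suc k"])
      qed
      have "nmem (nupd ''vis'' (nmem s2 ''ord'' (Suc k)) 1 s2) ''vis'' v \<noteq> 0 \<longleftrightarrow>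
        v \<in> nmem s2 ''ord'' ` {..<Suc (Suc k)}" if "v < n" for v
        unfolding img using I that by (auto simp: eqs)
      then show "runs (base n) (NSet ''vis'' (NGet ''ord'' (NAdd (scalar ''k'') (NConst 1))) (NConst 1)) s2
        (?I (Suc k))"
        using so by (intro runs_NSet) (simp add: eqs)
    qed
  next
    fix s' assume "frame ?F ?s s'"
    then show "nval (NSub (scalar ''n'') (NConst 1)) s' = n - 1"
      using rdy by (simp add: frame_def ready_def)
  next
    show "?I 0 ?s" using n ord0 vis by (auto simp: search_order_def lessThan_Suc)
  qed (use base_bounds(2)[of n] in auto)
  then have "runs (base n) Order s (?I (n - 1))"
    unfolding Order_def by (intro runs_NSet_Seq) simp
  then show ?thesis by (rule runs_conseq) (use n in simp)
qed

section \<open>Tables of single nodes\<close>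

definition Init :: com where
  "Init = For ''i'' (scalar ''n'')
    (Seq (NSet ''z'' (NConst 0) (scalar ''i''))
    (Seq (NSet ''m'' (NConst 0) (NConst 1))
    (Seq (NSet ''q'' (NConst 0) (NConst 0))
    (Seq (RSet ''r'' (NConst 0) (RConst 0))
    (Seq (For ''u'' (scalar ''n'') (NSet ''d'' (scalar ''u'') (NConst 0)))
    (Seq Put
    (Seq (NSet ''m'' (NConst 0) (NConst 0))
    (Seq (RSet ''r'' (NConst 0) (RGet ''cost'' (NGet ''ord'' (scalar ''i''))))
    (Seq (NSet ''d'' (NGet ''ord'' (scalar ''i'')) (NConst 1))
    (Seq Put
      (NSet ''ptr'' (scalar ''i'') (scalar ''i''))))))))))))"

lemma writes_Init [simp]:
  "nwrites Init = {''i'', ''z'', ''m'', ''q'', ''u'', ''d'', ''val'', ''bit'', ''ptr''}"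
  "rwrites Init = {''r'', ''cst''}"
  by (auto simp: Init_def)

text \<open>A single node is kept at cost 0 or removed at its own cost. The array \<open>d\<close>
  is cleared in each round since the previous one left a mark. Slots from \<open>n\<close> on must
  stay empty because merging will fill them.\<close>

lemma runs_Init:
  assumes rdy: "ready n E c b s" and ord: "\<And>i. i < n \<Longrightarrow> nmem s ''ord'' i < n"
    and empty: "\<And>z m q. m < base n \<Longrightarrow> q < base n \<Longrightarrow> tbl n s z m q = None"
  shows "runs (base n) Init s (\<lambda>s'.
    (\<forall>i<n. nmem s' ''ptr'' i = i \<and> represents (base n) c (tbl n s' i)
      (candidates E {nmem s ''ord'' i} (nmem s ''ord'' i))) \<and>
    (\<forall>z\<ge>n. \<forall>m<base n. \<forall>q<base n. tbl n s' z m q = None))"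
proof -
  let ?B = "base n"
  let ?I = "\<lambda>k s'. (\<forall>i<k. nmem s' ''ptr'' i = i \<and> represents (base n) c (tbl n s' i)
      (candidates E {nmem s ''ord'' i} (nmem s ''ord'' i))) \<and>
    (\<forall>z\<ge>k. \<forall>m<base n. \<forall>q<base n. tbl n s' z m q = None)"
  show ?thesis unfolding Init_def
  proof (rule runs_For[where I = ?I])
    let ?U = "For ''u'' (scalar ''n'') (NSet ''d'' (scalar ''u'') (NConst 0))"
    fix i s1 assume i: "i < n" and I1: "?I i s1" and i1: "nmem s1 ''i'' 0 = i"
      and f1: "frame (For ''i'' (scalar ''n'')
        (Seq (NSet ''z'' (NConst 0) (scalar ''i''))
        (Seq (NSet ''m'' (NConst 0) (NConst 1))
        (Seq (NSet ''q'' (NConst 0) (NConst 0))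
        (Seq (RSet ''r'' (NConst 0) (RConst 0))
        (Seq ?U
        (Seq Put
        (Seq (NSet ''m'' (NConst 0) (NConst 0))
        (Seq (RSet ''r'' (NConst 0) (RGet ''cost'' (NGet ''ord'' (scalar ''i''))))
        (Seq (NSet ''d'' (NGet ''ord'' (scalar ''i'')) (NConst 1))
        (Seq Put
          (NSet ''ptr'' (scalar ''i'') (scalar ''i'')))))))))))) ) s s1"
    have r1: "ready n E c b s1"
      using f1 rdy by (rule ready_frame) (auto simp: input_nats_def input_reals_def)
    have ord1: "nmem s1 ''ord'' = nmem s ''ord''" using f1 by (simp add: frame_def)
    let ?v = "nmem s ''ord'' i"
    have v: "?v < n" using ord i by simp
    have B1: "1 < ?B" "i \<le> ?B" using i base_bounds[of n] by (auto simp: base_def)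
    let ?s2 = "rupd ''r'' 0 0 (nupd ''q'' 0 0 (nupd ''m'' 0 1 (nupd ''z'' 0 i s1)))"
    have r2: "ready n E c b ?s2" using r1 by (simp add: input_nats_def input_reals_def)
    have U: "runs ?B ?U ?s2 (\<lambda>s'. \<forall>u<n. nmem s' ''d'' u = 0)"
    proof (rule runs_For[where I = "\<lambda>k s'. \<forall>u<k. nmem s' ''d'' u = 0"])
      fix k and s' :: store assume "\<forall>u<k. nmem s' ''d'' u = 0" "nmem s' ''u'' 0 = k"
      then show "runs ?B (NSet ''d'' (scalar ''u'') (NConst 0)) s' (\<lambda>s'. \<forall>u<Suc k. nmem s' ''d'' u = 0)"
        by (intro runs_NSet) (simp add: less_Suc_eq)
    next
      fix s' assume "frame ?U ?s2 s'"
      then show "nval (scalar ''n'') s' = n" using r1 by (simp add: frame_def ready_def)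
    qed (simp_all add: base_bounds)
    have body: "runs ?B (Seq ?U
        (Seq Put
        (Seq (NSet ''m'' (NConst 0) (NConst 0))
        (Seq (RSet ''r'' (NConst 0) (RGet ''cost'' (NGet ''ord'' (scalar ''i''))))
        (Seq (NSet ''d'' (NGet ''ord'' (scalar ''i'')) (NConst 1))
        (Seq Put
          (NSet ''ptr'' (scalar ''i'') (scalar ''i''))))))))
      ?s2 (?I (Suc i))"
    proof (rule runs_Seq[OF U])
      fix s3 assume f3: "frame ?U ?s2 s3" and d3: "\<forall>u<n. nmem s3 ''d'' u = 0"
      have r3: "ready n E c b s3"
        using f3 r2 by (rule ready_frame) (auto simp: input_nats_def input_reals_def)
      have e3: "nmem s3 ''z'' 0 = i" "nmem s3 ''m'' 0 = 1" "nmem s3 ''q'' 0 = 0" "rmem s3 ''r'' 0 = 0"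
        "nmem s3 ''i'' 0 = i" "nmem s3 ''ord'' = nmem s ''ord''" "nmem s3 ''ptr'' = nmem s1 ''ptr''"
        using f3 i1 ord1 by (simp_all add: frame_def)
      have t3: "tbl n s3 = tbl n s1" using tbl_frame[OF f3] by simp
      have D3: "{} = {u. u < n \<and> nmem s3 ''d'' u \<noteq> 0}" using d3 by auto
      show "runs ?B (Seq Put
        (Seq (NSet ''m'' (NConst 0) (NConst 0))
        (Seq (RSet ''r'' (NConst 0) (RGet ''cost'' (NGet ''ord'' (scalar ''i''))))
        (Seq (NSet ''d'' (NGet ''ord'' (scalar ''i'')) (NConst 1))
        (Seq Put
          (NSet ''ptr'' (scalar ''i'') (scalar ''i''))))))) s3 (?I (Suc i))"
      proof (rule runs_Seq[OF runs_Put[OF r3 e3(1) B1(2) e3(2) B1(1) e3(3) base_bounds(3) e3(4) D3]])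
        fix s4 assume f4: "frame Put s3 s4"
          and t4: "\<forall>z' m' q'. m' < ?B \<longrightarrow> q' < ?B \<longrightarrow> tbl n s4 z' m' q' =
            (if z' = i \<and> m' = 1 \<and> q' = 0 \<and> improves (tbl n s3 i) 1 0 0 then Some (0, {})
             else tbl n s3 z' m' q')"
        have r4: "ready n E c b s4"
          using f4 r3 by (rule ready_frame) (auto simp: input_nats_def input_reals_def)
        have e4: "nmem s4 ''z'' 0 = i" "nmem s4 ''q'' 0 = 0" "nmem s4 ''i'' 0 = i"
          "nmem s4 ''ord'' = nmem s ''ord''" "nmem s4 ''ptr'' = nmem s1 ''ptr''"
          "nmem s4 ''d'' = nmem s3 ''d''"
          using f4 e3 by (simp_all add: frame_def)
        let ?s5 = "nupd ''d'' ?v 1 (rupd ''r'' 0 (c ?v) (nupd ''m'' 0 0 s4))"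
        have r5: "ready n E c b ?s5" using r4 by (simp add: input_nats_def input_reals_def)
        have e5: "nmem ?s5 ''z'' 0 = i" "nmem ?s5 ''m'' 0 = 0" "nmem ?s5 ''q'' 0 = 0"
          "rmem ?s5 ''r'' 0 = c ?v" by (simp_all add: e4)
        have D5: "{?v} = {u. u < n \<and> nmem ?s5 ''d'' u \<noteq> 0}" using v d3 by (auto simp: e4)
        have cv: "rmem s4 ''cost'' ?v = c ?v" using r4 v by (simp add: ready_def)
        have last: "runs ?B (Seq Put (NSet ''ptr'' (scalar ''i'') (scalar ''i''))) ?s5 (?I (Suc i))"
        proof (rule runs_Seq[OF runs_Put[OF r5 e5(1) B1(2) e5(2) base_bounds(3) e5(3) base_bounds(3)
                e5(4) D5]])
          fix s6 assume f6: "frame Put ?s5 s6"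
            and t6: "\<forall>z' m' q'. m' < ?B \<longrightarrow> q' < ?B \<longrightarrow> tbl n s6 z' m' q' =
              (if z' = i \<and> m' = 0 \<and> q' = 0 \<and> improves (tbl n ?s5 i) 0 0 (c ?v)
               then Some (c ?v, {?v}) else tbl n ?s5 z' m' q')"
          have e6: "nmem s6 ''i'' 0 = i" "nmem s6 ''ptr'' = nmem s1 ''ptr''"
            using f6 by (simp_all add: frame_def e4)
          have t5: "tbl n ?s5 = tbl n s4" by simp
          \<comment> \<open>An empty table represents the empty family; the two calls of
            \<open>Put\<close> then insert the two candidates of a single node one by one.\<close>
          have "represents ?B c (tbl n s3 i) {}"
            unfolding t3 represents_def using I1 by auto
          then have "represents ?B c (tbl n s4 i) (insert (1, 0, {}) {})"
            by (rule represents_insert) (use t4 B1 base_bounds in auto)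
          then have "represents ?B c (tbl n s6 i) (insert (0, 0, {?v}) (insert (1, 0, {}) {}))"
            by (rule represents_insert) (use t6 base_bounds in \<open>auto simp: t5\<close>)
          then have new: "represents ?B c (tbl n s6 i) (candidates E {?v} ?v)"
            by (simp add: candidates_single insert_commute)
          have old: "tbl n s6 z m q = tbl n s1 z m q" if "z \<noteq> i" "m < ?B" "q < ?B" for z m q
            using t6 t4 that by (simp add: t5 t3)
          have "represents ?B c (tbl n s6 j) (candidates E {nmem s ''ord'' j} (nmem s ''ord'' j))"
            if "j < i" for j
            by (rule represents_cong[of _ _ "tbl n s1 j"]) (use I1 that old in auto)
          then show "runs ?B (NSet ''ptr'' (scalar ''i'') (scalar ''i'')) s6 (?I (Suc i))"
            using new I1 old by (intro runs_NSet) (auto simp: e6 less_Suc_eq)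
        qed
        show "runs ?B (Seq (NSet ''m'' (NConst 0) (NConst 0))
          (Seq (RSet ''r'' (NConst 0) (RGet ''cost'' (NGet ''ord'' (scalar ''i''))))
          (Seq (NSet ''d'' (NGet ''ord'' (scalar ''i'')) (NConst 1))
          (Seq Put
            (NSet ''ptr'' (scalar ''i'') (scalar ''i'')))))) s4 (?I (Suc i))"
          using last by (intro runs_NSet_Seq runs_RSet_Seq) (simp add: e4 cv)
      qed
    qed
    show "runs ?B
        (Seq (NSet ''z'' (NConst 0) (scalar ''i''))
        (Seq (NSet ''m'' (NConst 0) (NConst 1))
        (Seq (NSet ''q'' (NConst 0) (NConst 0))
        (Seq (RSet ''r'' (NConst 0) (RConst 0))
        (Seq ?U
        (Seq Put
        (Seq (NSet ''m'' (NConst 0) (NConst 0))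
        (Seq (RSet ''r'' (NConst 0) (RGet ''cost'' (NGet ''ord'' (scalar ''i''))))
        (Seq (NSet ''d'' (NGet ''ord'' (scalar ''i'')) (NConst 1))
        (Seq Put
          (NSet ''ptr'' (scalar ''i'') (scalar ''i'')))))))))))) s1 (?I (Suc i))"
      using body by (intro runs_NSet_Seq runs_RSet_Seq) (simp add: i1)
  qed (use rdy empty in \<open>auto simp: base_bounds frame_def ready_def\<close>)
qed

section \<open>Merging two tables\<close>

definition Combine :: com where
  "Combine = Cond (BAnd
      (NLess (NConst 0) (NGet ''val'' (cellE (scalar ''x'') (scalar ''m1'') (scalar ''q1''))))
      (NLess (NConst 0) (NGet ''val'' (cellE (scalar ''y'') (scalar ''m2'') (scalar ''q2'')))))
    (Seq (Cond (NLess (NConst 0) (scalar ''m1''))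
        (NSet ''m'' (NConst 0) (NAdd (scalar ''m1'') (scalar ''m2'')))
        (NSet ''m'' (NConst 0) (NConst 0)))
    (Seq (NSet ''q'' (NConst 0) (NAdd (NAdd (scalar ''q1'') (scalar ''q2''))
        (NAdd (NGet ''pm'' (scalar ''m2'')) (NGet ''pm'' (scalar ''m2'')))))
    (Seq (RSet ''r'' (NConst 0)
        (RAdd (RGet ''cst'' (cellE (scalar ''x'') (scalar ''m1'') (scalar ''q1'')))
          (RGet ''cst'' (cellE (scalar ''y'') (scalar ''m2'') (scalar ''q2'')))))
    (Seq (For ''u'' (scalar ''n'') (NSet ''d'' (scalar ''u'') (NAdd
        (NGet ''bit'' (bitE (scalar ''x'') (scalar ''m1'') (scalar ''q1'') (scalar ''u'')))
        (NGet ''bit'' (bitE (scalar ''y'') (scalar ''m2'') (scalar ''q2'') (scalar ''u''))))))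
      Put))))
    Skip"

lemma writes_Combine [simp]:
  "nwrites Combine = {''m'', ''q'', ''u'', ''d'', ''val'', ''bit''}" "rwrites Combine = {''r'', ''cst''}"
  by (auto simp: Combine_def)

text \<open>At most one triple per index quadruple; indexing by quadruples turns the work of four
  nested loops into a union.\<close>

definition combinations :: "table \<Rightarrow> table \<Rightarrow> nat \<times> nat \<times> nat \<times> nat \<Rightarrow> (nat \<times> nat \<times> nat set) set" where
  "combinations t1 t2 = (\<lambda>(m1, q1, m2, q2). {combine (m1, q1, D1) (m2, q2, D2) | r1 D1 r2 D2.
    t1 m1 q1 = Some (r1, D1) \<and> t2 m2 q2 = Some (r2, D2)})"

text \<open>Says of the tables alone that results stay in range and costs add up. This keeps the
  program proofs free of graph theory.\<close>

definition mergeable :: "nat \<Rightarrow> (nat \<Rightarrow> real) \<Rightarrow> table \<Rightarrow> table \<Rightarrow> bool" where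
  "mergeable B c t1 t2 \<longleftrightarrow> (\<forall>m1 q1 r1 D1 m2 q2 r2 D2 m q D.
    m1 < B \<longrightarrow> q1 < B \<longrightarrow> m2 < B \<longrightarrow> q2 < B \<longrightarrow>
    t1 m1 q1 = Some (r1, D1) \<longrightarrow> t2 m2 q2 = Some (r2, D2) \<longrightarrow>
    combine (m1, q1, D1) (m2, q2, D2) = (m, q, D) \<longrightarrow> m < B \<and> q < B \<and> r1 + r2 = sum c D)"

text \<open>The product \<open>m1 * m2\<close> is looked up in \<open>pm\<close> and added twice.
  Bit vectors are united by addition: a sum of naturals is nonzero iff a summand is.\<close>

lemma runs_Combine:
  assumes rdy: "ready n E c b s"
    and x: "nmem s ''x'' 0 = x" "x \<le> base n" and y: "nmem s ''y'' 0 = y" "y \<le> base n"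
    and z: "nmem s ''z'' 0 = z" "z \<le> base n"
    and m1: "nmem s ''m1'' 0 = m1" "m1 < base n" and q1: "nmem s ''q1'' 0 = q1" "q1 < base n"
    and m2: "nmem s ''m2'' 0 = m2" "m2 < base n" and q2: "nmem s ''q2'' 0 = q2" "q2 < base n"
    and pm: "nmem s ''pm'' m2 = m2 * m1"
    and ok: "mergeable (base n) c (tbl n s x) (tbl n s y)"
    and rep: "represents (base n) c (tbl n s z) F"
  shows "runs (base n) Combine s (\<lambda>s'.
    (\<forall>z' m q. z' \<noteq> z \<longrightarrow> m < base n \<longrightarrow> q < base n \<longrightarrow> tbl n s' z' m q = tbl n s z' m q) \<and>
    represents (base n) c (tbl n s' z) (F \<union> combinations (tbl n s x) (tbl n s y) (m1, q1, m2, q2)))"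
    (is "runs _ _ _ ?Q")
proof -
  let ?B = "base n"
  let ?t = "BAnd
      (NLess (NConst 0) (NGet ''val'' (cellE (scalar ''x'') (scalar ''m1'') (scalar ''q1''))))
      (NLess (NConst 0) (NGet ''val'' (cellE (scalar ''y'') (scalar ''m2'') (scalar ''q2''))))"
  let ?cx = "cell n x m1 q1" and ?cy = "cell n y m2 q2"
  have cells: "nval (cellE (scalar ''x'') (scalar ''m1'') (scalar ''q1'')) s' = ?cx"
    "nval (cellE (scalar ''y'') (scalar ''m2'') (scalar ''q2'')) s' = ?cy"
    if "ready n E c b s'" "nmem s' ''x'' 0 = x" "nmem s' ''y'' 0 = y" "nmem s' ''m1'' 0 = m1"
      "nmem s' ''m2'' 0 = m2" "nmem s' ''q1'' 0 = q1" "nmem s' ''q2'' 0 = q2" for s'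
    using nval_cellE[OF that(1), of "scalar ''x''" "scalar ''m1''"]
      nval_cellE[OF that(1), of "scalar ''y''" "scalar ''m2''"] that x y m1 m2 by simp_all
  have test: "bval ?t s \<longleftrightarrow> tbl n s x m1 q1 \<noteq> None \<and> tbl n s y m2 q2 \<noteq> None"
    using cells[OF rdy x(1) y(1) m1(1) m2(1) q1(1) q2(1)] by (simp add: tbl_def)
  show ?thesis unfolding Combine_def
  proof (rule runs_Cond)
    assume "\<not> bval ?t s"
    then have "combinations (tbl n s x) (tbl n s y) (m1, q1, m2, q2) = {}"
      unfolding test by (auto simp: combinations_def)
    then show "runs ?B Skip s ?Q" using rep by (intro runs_Skip) simp
  next
    let ?D1 = "{u. u < n \<and> nmem s ''bit'' (?cx * ?B + u) \<noteq> 0}"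
    let ?D2 = "{u. u < n \<and> nmem s ''bit'' (?cy * ?B + u) \<noteq> 0}"
    let ?r1 = "rmem s ''cst'' ?cx" and ?r2 = "rmem s ''cst'' ?cy"
    assume "bval ?t s"
    then have t: "tbl n s x m1 q1 = Some (?r1, ?D1)" "tbl n s y m2 q2 = Some (?r2, ?D2)"
      unfolding test by (auto simp: tbl_def split: if_splits)
    define m q D where "m = (if m1 = 0 then 0 else m1 + m2)"
      and "q = q1 + q2 + 2 * (m1 * m2)" and "D = ?D1 \<union> ?D2"
    have comb: "combine (m1, q1, ?D1) (m2, q2, ?D2) = (m, q, D)"
      by (simp add: m_def q_def D_def)
    have bnd: "m < ?B" "q < ?B" "?r1 + ?r2 = sum c D"
      using ok[unfolded mergeable_def, rule_format, OF m1(2) q1(2) m2(2) q2(2) t comb] by simp_all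
    have combs: "combinations (tbl n s x) (tbl n s y) (m1, q1, m2, q2) = {(m, q, D)}"
      using t comb by (auto simp: combinations_def simp del: combine.simps)
    let ?M = "Cond (NLess (NConst 0) (scalar ''m1''))
        (NSet ''m'' (NConst 0) (NAdd (scalar ''m1'') (scalar ''m2'')))
        (NSet ''m'' (NConst 0) (NConst 0))"
    let ?qe = "NAdd (NAdd (scalar ''q1'') (scalar ''q2''))
        (NAdd (NGet ''pm'' (scalar ''m2'')) (NGet ''pm'' (scalar ''m2'')))"
    let ?re = "RAdd (RGet ''cst'' (cellE (scalar ''x'') (scalar ''m1'') (scalar ''q1'')))
          (RGet ''cst'' (cellE (scalar ''y'') (scalar ''m2'') (scalar ''q2'')))"
    let ?W = "NSet ''d'' (scalar ''u'') (NAdd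
        (NGet ''bit'' (bitE (scalar ''x'') (scalar ''m1'') (scalar ''q1'') (scalar ''u'')))
        (NGet ''bit'' (bitE (scalar ''y'') (scalar ''m2'') (scalar ''q2'') (scalar ''u''))))"
    let ?U = "For ''u'' (scalar ''n'') ?W"
    let ?s1 = "nupd ''m'' 0 m s" and ?s2 = "nupd ''q'' 0 q (nupd ''m'' 0 m s)"
    let ?s3 = "rupd ''r'' 0 (?r1 + ?r2) ?s2"
    have r3: "ready n E c b ?s3" using rdy by (simp add: input_nats_def input_reals_def)
    have r2: "ready n E c b ?s2" using rdy by (simp add: input_nats_def)
    have U: "runs ?B ?U ?s3 (\<lambda>s'. \<forall>u<n. nmem s' ''d'' u \<noteq> 0 \<longleftrightarrow> u \<in> D)"
    proof (rule runs_For[where I = "\<lambda>i s'. \<forall>u<i. nmem s' ''d'' u \<noteq> 0 \<longleftrightarrow> u \<in> D"])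
      fix i s' assume i: "i < n" and I: "\<forall>u<i. nmem s' ''d'' u \<noteq> 0 \<longleftrightarrow> u \<in> D"
        and u: "nmem s' ''u'' 0 = i" and f: "frame ?U ?s3 s'"
      have r': "ready n E c b s'"
        using f r3 by (rule ready_frame) (auto simp: input_nats_def input_reals_def)
      have e: "nmem s' ''x'' 0 = x" "nmem s' ''y'' 0 = y" "nmem s' ''m1'' 0 = m1"
        "nmem s' ''m2'' 0 = m2" "nmem s' ''q1'' 0 = q1" "nmem s' ''q2'' 0 = q2"
        "nmem s' ''bit'' = nmem s ''bit''"
        using f x y m1 m2 q1 q2 by (simp_all add: frame_def)
      have bits: "nval (bitE (scalar ''x'') (scalar ''m1'') (scalar ''q1'') (scalar ''u'')) s' = ?cx * ?B + i"
        "nval (bitE (scalar ''y'') (scalar ''m2'') (scalar ''q2'') (scalar ''u'')) s' = ?cy * ?B + i"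
        using nval_bitE[OF r', of "scalar ''x''" "scalar ''m1''" "scalar ''q1''" "scalar ''u''"]
          nval_bitE[OF r', of "scalar ''y''" "scalar ''m2''" "scalar ''q2''" "scalar ''u''"]
          e x y m1 m2 q1 q2 u by simp_all
      have iD: "i \<in> D \<longleftrightarrow> nmem s ''bit'' (?cx * ?B + i) + nmem s ''bit'' (?cy * ?B + i) \<noteq> 0"
        using i by (simp add: D_def)
      show "runs ?B ?W s' (\<lambda>s'. \<forall>u<Suc i. nmem s' ''d'' u \<noteq> 0 \<longleftrightarrow> u \<in> D)"
        using I iD by (intro runs_NSet) (auto simp: bits e u less_Suc_eq)
    next
      fix s' assume "frame ?U ?s3 s'"
      then show "nval (scalar ''n'') s' = n" using rdy by (simp add: frame_def ready_def)
    qed (simp_all add: base_bounds)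
    have body: "runs ?B (Seq ?U Put) ?s3 ?Q"
    proof (rule runs_Seq[OF U])
      fix s4 assume f4: "frame ?U ?s3 s4" and d4: "\<forall>u<n. nmem s4 ''d'' u \<noteq> 0 \<longleftrightarrow> u \<in> D"
      have r4: "ready n E c b s4"
        using f4 r3 by (rule ready_frame) (auto simp: input_nats_def input_reals_def)
      have e4: "nmem s4 ''z'' 0 = z" "nmem s4 ''m'' 0 = m" "nmem s4 ''q'' 0 = q"
        "rmem s4 ''r'' 0 = ?r1 + ?r2"
        using f4 z by (simp_all add: frame_def)
      have t4: "tbl n s4 = tbl n s" using tbl_frame[OF f4] by simp
      have D4: "D = {u. u < n \<and> nmem s4 ''d'' u \<noteq> 0}" using d4 by (auto simp: D_def)
      show "runs ?B Put s4 ?Q"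
      proof (rule runs_conseq[OF runs_Put[OF r4 e4(1) z(2) e4(2) bnd(1) e4(3) bnd(2) e4(4) D4]])
        fix s5 assume t5: "\<forall>z' m' q'. m' < ?B \<longrightarrow> q' < ?B \<longrightarrow> tbl n s5 z' m' q' =
            (if z' = z \<and> m' = m \<and> q' = q \<and> improves (tbl n s4 z) m q (?r1 + ?r2)
             then Some (?r1 + ?r2, D) else tbl n s4 z' m' q')"
        have "represents ?B c (tbl n s5 z) (insert (m, q, D) F)"
          using rep bnd by (rule represents_insert) (use t5 in \<open>simp add: t4\<close>)
        then show "?Q s5" using t5 by (simp add: combs t4)
      qed
    qed
    have M: "runs ?B ?M s (\<lambda>s'. s' = ?s1)"
      by (rule runs_Cond; rule runs_NSet) (simp_all add: m1 m2 m_def)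
    show "runs ?B (Seq ?M (Seq (NSet ''q'' (NConst 0) ?qe)
        (Seq (RSet ''r'' (NConst 0) ?re) (Seq ?U Put)))) s ?Q"
    proof (rule runs_Seq[OF M], hypsubst, rule runs_NSet_Seq, rule runs_RSet_Seq)
      have "nval ?qe ?s1 = q" using m1 m2 q1 q2 pm by (simp add: q_def mult.commute)
      then have s2: "nupd ''q'' (nval (NConst 0) ?s1) (nval ?qe ?s1) ?s1 = ?s2" by simp
      have re: "rval ?re ?s2 = ?r1 + ?r2"
        using cells[OF r2] x y m1 m2 q1 q2 by simp
      show "runs ?B (Seq ?U Put)
        (rupd ''r'' (nval (NConst 0) (nupd ''q'' (nval (NConst 0) ?s1) (nval ?qe ?s1) ?s1))
          (rval ?re (nupd ''q'' (nval (NConst 0) ?s1) (nval ?qe ?s1) ?s1))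
          (nupd ''q'' (nval (NConst 0) ?s1) (nval ?qe ?s1) ?s1)) ?Q"
        unfolding s2 re using body by simp
    qed
  qed
qed

text \<open>The multiples of \<open>m1\<close> are computed as soon as \<open>m1\<close> is fixed,
  hence in the outermost loop, and serve all inner rounds.\<close>

definition Merge :: com where
  "Merge = For ''m1'' (scalar ''B'')
    (Seq (Multiples ''pm'' (scalar ''m1'') (scalar ''B''))
      (For ''q1'' (scalar ''B'') (For ''m2'' (scalar ''B'') (For ''q2'' (scalar ''B'') Combine))))"

lemma writes_Merge [simp]:
  "nwrites Merge = {''m1'', ''pm'', ''i'', ''q1'', ''m2'', ''q2'', ''m'', ''q'', ''u'', ''d'', ''val'', ''bit''}"
  "rwrites Merge = {''r'', ''cst''}"
  by (auto simp: Merge_def)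

text \<open>The result goes to a third slot \<open>z\<close>, so that both input tables can be read
  unchanged until the last round.\<close>

lemma runs_Merge:
  assumes rdy: "ready n E c b s"
    and x: "nmem s ''x'' 0 = x" "x \<le> base n" and y: "nmem s ''y'' 0 = y" "y \<le> base n"
    and z: "nmem s ''z'' 0 = z" "z \<le> base n" "x \<noteq> z" "y \<noteq> z"
    and ok: "mergeable (base n) c (tbl n s x) (tbl n s y)"
    and rep: "represents (base n) c (tbl n s z) {}"
  shows "runs (base n) Merge s (\<lambda>s'.
    (\<forall>z' m q. z' \<noteq> z \<longrightarrow> m < base n \<longrightarrow> q < base n \<longrightarrow> tbl n s' z' m q = tbl n s z' m q) \<and>
    represents (base n) c (tbl n s' z)
      (\<Union>p \<in> {..<base n} \<times> {..<base n} \<times> {..<base n} \<times> {..<base n}.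
        combinations (tbl n s x) (tbl n s y) p))"
proof -
  let ?B = "base n"
  let ?C = "combinations (tbl n s x) (tbl n s y)"
  let ?J = "\<lambda>P s'.
    (\<forall>z' m q. z' \<noteq> z \<longrightarrow> m < ?B \<longrightarrow> q < ?B \<longrightarrow> tbl n s' z' m q = tbl n s z' m q) \<and>
    represents ?B c (tbl n s' z) (\<Union>p\<in>P. ?C p)"
  let ?F4 = "For ''q2'' (scalar ''B'') Combine"
  let ?F3 = "For ''m2'' (scalar ''B'') ?F4"
  let ?F2 = "For ''q1'' (scalar ''B'') ?F3"
  let ?F1 = "For ''m1'' (scalar ''B'') (Seq (Multiples ''pm'' (scalar ''m1'') (scalar ''B'')) ?F2)"
  have nB: "nval (scalar ''B'') s' = ?B" if "frame ?F1 s s'" for s'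
    using that rdy by (simp add: frame_def ready_def)
  have F2: "frame ?F1 s' s''" if "frame ?F2 s' s''" for s' s''
    using that by (rule frame_sub) auto
  have F3: "frame ?F2 s' s''" if "frame ?F3 s' s''" for s' s''
    using that by (rule frame_sub) auto
  have F4: "frame ?F3 s' s''" if "frame ?F4 s' s''" for s' s''
    using that by (rule frame_sub) auto
  have inner: "runs ?B Combine s' (?J (P \<union> {(m1, q1, m2, q2)}))"
    if J: "?J P s'" and fr: "frame ?F1 s s'"
      and v: "nmem s' ''m1'' 0 = m1" "nmem s' ''q1'' 0 = q1" "nmem s' ''m2'' 0 = m2"
        "nmem s' ''q2'' 0 = q2" "m1 < ?B" "q1 < ?B" "m2 < ?B" "q2 < ?B"
      and pm: "nmem s' ''pm'' m2 = m2 * m1" for P s' m1 q1 m2 q2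
  proof -
    have r': "ready n E c b s'"
      using fr rdy by (rule ready_frame) (auto simp: input_nats_def input_reals_def)
    have e: "nmem s' ''x'' 0 = x" "nmem s' ''y'' 0 = y" "nmem s' ''z'' 0 = z"
      using fr x y z by (simp_all add: frame_def)
    have tx: "tbl n s' x m q = tbl n s x m q" and ty: "tbl n s' y m q = tbl n s y m q"
      if "m < ?B" "q < ?B" for m q
      using J that z by auto
    have ok': "mergeable ?B c (tbl n s' x) (tbl n s' y)"
      unfolding mergeable_def
    proof (intro allI impI)
      fix m1 q1 r1 D1 m2 q2 r2 D2 m q D
      assume "m1 < ?B" "q1 < ?B" "m2 < ?B" "q2 < ?B" "tbl n s' x m1 q1 = Some (r1, D1)"
        "tbl n s' y m2 q2 = Some (r2, D2)" "combine (m1, q1, D1) (m2, q2, D2) = (m, q, D)"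
      then show "m < ?B \<and> q < ?B \<and> r1 + r2 = sum c D"
        by (intro ok[unfolded mergeable_def, rule_format, of m1 q1 m2 q2 r1 D1 r2 D2])
          (simp_all only: tx ty)
    qed
    have Ceq: "combinations (tbl n s' x) (tbl n s' y) (m1, q1, m2, q2) = ?C (m1, q1, m2, q2)"
      using v by (simp add: combinations_def tx ty)
    have "runs ?B Combine s' (\<lambda>s''.
      (\<forall>z' m q. z' \<noteq> z \<longrightarrow> m < ?B \<longrightarrow> q < ?B \<longrightarrow> tbl n s'' z' m q = tbl n s' z' m q) \<and>
      represents ?B c (tbl n s'' z) ((\<Union>p\<in>P. ?C p) \<union> ?C (m1, q1, m2, q2)))"
      unfolding Ceq[symmetric]
      by (rule runs_Combine[OF r' e(1) x(2) e(2) y(2) e(3) z(2) v(1) v(5) v(2) v(6) v(3) v(7) v(4) v(8)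
            pm ok' conjunct2[OF J]])
    then show ?thesis
    proof (rule runs_conseq)
      fix s'' assume *: "(\<forall>z' m q. z' \<noteq> z \<longrightarrow> m < ?B \<longrightarrow> q < ?B \<longrightarrow>
          tbl n s'' z' m q = tbl n s' z' m q) \<and>
        represents ?B c (tbl n s'' z) ((\<Union>p\<in>P. ?C p) \<union> ?C (m1, q1, m2, q2))"
      have "(\<Union>p\<in>P \<union> {(m1, q1, m2, q2)}. ?C p) = (\<Union>p\<in>P. ?C p) \<union> ?C (m1, q1, m2, q2)" by auto
      then show "?J (P \<union> {(m1, q1, m2, q2)}) s''" using * J by simp
    qed
  qed
  have "runs ?B Merge s (?J ({} \<union>
    (\<Union>m1<?B. \<Union>q1<?B. \<Union>m2<?B. \<Union>q2<?B. {(m1, q1, m2, q2)})))"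
    unfolding Merge_def
  proof (rule runs_For_union[where J = ?J])
    fix m1 P1 s1 assume m1: "m1 < ?B" "nmem s1 ''m1'' 0 = m1" and J1: "?J P1 s1"
      and f1: "frame ?F1 s s1"
    let ?M = "Multiples ''pm'' (scalar ''m1'') (scalar ''B'')"
    have fM: "frame ?F1 s s'" if "frame ?M s1 s'" for s'
      using frame_trans[OF f1 frame_sub[OF that]] by simp
    have "runs ?B ?M s1 (\<lambda>s'. \<forall>x\<le>?B. nmem s' ''pm'' x = x * m1)"
    proof (rule runs_Multiples)
      fix s' assume f: "frame ?M s1 s'"
      then show "nval (scalar ''m1'') s' = m1" using m1 by (simp add: frame_def)
      show "nval (scalar ''B'') s' = ?B" using nB[OF fM[OF f]] .
    qed auto
    then show "runs ?B (Seq ?M ?F2) s1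
      (?J (P1 \<union> (\<Union>q1<?B. \<Union>m2<?B. \<Union>q2<?B. {(m1, q1, m2, q2)})))"
    proof (rule runs_Seq)
      fix s1' assume f1': "frame ?M s1 s1'" and pm: "\<forall>x\<le>?B. nmem s1' ''pm'' x = x * m1"
      have m1': "nmem s1' ''m1'' 0 = m1" using f1' m1 by (simp add: frame_def)
      have J1': "?J P1 s1'" using J1 tbl_frame[OF f1'] by simp
      note g1 = fM[OF f1']
      show "runs ?B ?F2 s1' (?J (P1 \<union> (\<Union>q1<?B. \<Union>m2<?B. \<Union>q2<?B. {(m1, q1, m2, q2)})))"
      proof (rule runs_For_union[where J = ?J])
        fix q1 P2 s2 assume q1: "q1 < ?B" "nmem s2 ''q1'' 0 = q1" and J2: "?J P2 s2"
          and f2: "frame ?F2 s1' s2"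
        note g2 = frame_trans[OF g1 F2[OF f2]]
        show "runs ?B ?F3 s2 (?J (P2 \<union> (\<Union>m2<?B. \<Union>q2<?B. {(m1, q1, m2, q2)})))"
        proof (rule runs_For_union[where J = ?J])
          fix m2 P3 s3 assume m2: "m2 < ?B" "nmem s3 ''m2'' 0 = m2" and J3: "?J P3 s3"
            and f3: "frame ?F3 s2 s3"
          note g3 = frame_trans[OF g2 F2[OF F3[OF f3]]]
          show "runs ?B ?F4 s3 (?J (P3 \<union> (\<Union>q2<?B. {(m1, q1, m2, q2)})))"
          proof (rule runs_For_union[where J = ?J])
            fix q2 P4 s4 assume q2: "q2 < ?B" "nmem s4 ''q2'' 0 = q2" and J4: "?J P4 s4"
              and f4: "frame ?F4 s3 s4"
            note g4 = frame_trans[OF g3 F2[OF F3[OF F4[OF f4]]]]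
            have e: "nmem s4 ''m1'' 0 = m1" "nmem s4 ''q1'' 0 = q1" "nmem s4 ''m2'' 0 = m2"
              "nmem s4 ''pm'' = nmem s1' ''pm''"
              using f2 f3 f4 m1' q1 m2 by (simp_all add: frame_def)
            show "runs ?B Combine s4 (?J (P4 \<union> {(m1, q1, m2, q2)}))"
              by (rule inner[OF J4 g4 e(1-3) q2(2) m1(1) q1(1) m2(1) q2(1)]) (use pm m2 e in simp)
          next
            fix s' assume "frame ?F4 s3 s'"
            then show "nval (scalar ''B'') s' = ?B"
              using nB[OF frame_trans[OF g3 F2[OF F3[OF F4]]]] by blast
          qed (use J3 in auto)
        next
          fix s' assume "frame ?F3 s2 s'"
          then show "nval (scalar ''B'') s' = ?B"
            using nB[OF frame_trans[OF g2 F2[OF F3]]] by blast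
        qed (use J2 in auto)
      next
        fix s' assume "frame ?F2 s1' s'"
        then show "nval (scalar ''B'') s' = ?B"
          using nB[OF frame_trans[OF g1 F2]] by blast
      qed (use J1' in auto)
    qed
  qed (use rep nB in auto)
  moreover have "{} \<union> (\<Union>m1<?B. \<Union>q1<?B. \<Union>m2<?B. \<Union>q2<?B. {(m1, q1, m2, q2)}) =
    {..<?B} \<times> {..<?B} \<times> {..<?B} \<times> {..<?B}" by auto
  ultimately show ?thesis by (simp only:)
qed

section \<open>Merging along the tree\<close>

definition Merges :: com where
  "Merges = For ''k'' (NSub (scalar ''n'') (NConst 1))
    (Seq (NSet ''a'' (NConst 0) (NSub (scalar ''n'') (NAdd (scalar ''k'') (NConst 1))))
    (Seq (NSet ''p'' (NConst 0) (NGet ''par'' (scalar ''a'')))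
    (Seq (NSet ''x'' (NConst 0) (NGet ''ptr'' (scalar ''p'')))
    (Seq (NSet ''y'' (NConst 0) (NGet ''ptr'' (scalar ''a'')))
    (Seq (NSet ''z'' (NConst 0) (NAdd (scalar ''n'') (scalar ''k'')))
    (Seq Merge
      (NSet ''ptr'' (scalar ''p'') (scalar ''z''))))))))"

lemma writes_Merges [simp]:
  "nwrites Merges = {''k'', ''a'', ''p'', ''x'', ''y'', ''z'', ''ptr''} \<union> nwrites Merge"
  "rwrites Merges = {''r'', ''cst''}"
  by (auto simp: Merges_def)

text \<open>After \<open>k\<close> rounds \<open>n - k\<close> blocks are left and slots from
  \<open>n + k\<close> on are empty. The blocks are not stored anywhere, hence the existential
  quantifier; \<open>ptr i\<close> tells which slot holds the table of block
  \<open>i\<close>.\<close>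

definition merged ::
    "nat \<Rightarrow> nat set set \<Rightarrow> (nat \<Rightarrow> real) \<Rightarrow> (nat \<Rightarrow> nat) \<Rightarrow> (nat \<Rightarrow> nat) \<Rightarrow> nat \<Rightarrow> store \<Rightarrow> bool" where
  "merged n E c ord par k s \<longleftrightarrow>
    (\<exists>bk. blocks n ord par (n - k) bk \<and>
      (\<forall>i<n - k. nmem s ''ptr'' i < n + k \<and>
        represents (base n) c (tbl n s (nmem s ''ptr'' i)) (candidates E (bk i) (ord i)))) \<and>
    (\<forall>z\<ge>n + k. \<forall>m<base n. \<forall>q<base n. tbl n s z m q = None)"

text \<open>Index bounds of the two parts would not bound their combination. The result is in range
  because it is itself a candidate of \<open>F \<union> G\<close>, which has at most
  \<open>n\<close> nodes.\<close>

lemma mergeable_candidates: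
  assumes t: "represents B c t1 (candidates E F u)" "represents B c t2 (candidates E G a)"
    and edge: "{u, a} \<in> E" and dis: "F \<inter> G = {}" and FG: "F \<union> G \<subseteq> {..<n}" and B: "n * n < B" "n < B"
    and only: "\<And>x y. x \<in> F \<Longrightarrow> y \<in> G \<Longrightarrow> {x, y} \<in> E \<Longrightarrow> x = u \<and> y = a"
    and mem: "u \<in> F" "a \<in> G"
  shows "mergeable B c t1 t2"
  unfolding mergeable_def
proof (intro allI impI)
  fix m1 q1 r1 D1 m2 q2 r2 D2 m q D
  assume *: "m1 < B" "q1 < B" "m2 < B" "q2 < B" "t1 m1 q1 = Some (r1, D1)"
    "t2 m2 q2 = Some (r2, D2)" and comb: "combine (m1, q1, D1) (m2, q2, D2) = (m, q, D)"
  have fin: "finite F" "finite G" using FG by (auto intro: finite_subset)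
  have p: "(m1, q1, D1) \<in> candidates E F u" "r1 = sum c D1"
    "(m2, q2, D2) \<in> candidates E G a" "r2 = sum c D2"
    using represents_sound[OF t(1) *(1,2,5)] represents_sound[OF t(2) *(3,4,6)] by auto
  have "D1 \<subseteq> F" "D2 \<subseteq> G" using candidates_bound(3) p FG by (metis le_sup_iff)+
  then have "sum c (D1 \<union> D2) = r1 + r2"
    unfolding p using dis fin by (intro sum.union_disjoint) (auto intro: finite_subset)
  moreover have "(m, q, D) \<in> candidates E (F \<union> G) u"
  proof (subst candidates_join[OF edge dis fin only mem])
    show "(m, q, D) \<in> {combine P Q | P Q. P \<in> candidates E F u \<and> Q \<in> candidates E G a}"
      using p comb by (metis (mono_tags, lifting) mem_Collect_eq)
  qed
  then have "m \<le> n" "q \<le> n * n" using candidates_bound[OF _ FG] by blast+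
  ultimately show "m < B \<and> q < B \<and> r1 + r2 = sum c D" using B comb by auto
qed

lemma runs_Merges:
  assumes rdy: "ready n E c b s" and tree: "is_tree {..<n} E"
    and so: "search_order E n ord (nmem s ''par'') n" and init: "merged n E c ord (nmem s ''par'') 0 s"
  shows "runs (base n) Merges s (merged n E c ord (nmem s ''par'') (n - 1))"
proof -
  let ?B = "base n" and ?par = "nmem s ''par''"
  let ?C = "Seq (NSet ''a'' (NConst 0) (NSub (scalar ''n'') (NAdd (scalar ''k'') (NConst 1))))
    (Seq (NSet ''p'' (NConst 0) (NGet ''par'' (scalar ''a'')))
    (Seq (NSet ''x'' (NConst 0) (NGet ''ptr'' (scalar ''p'')))
    (Seq (NSet ''y'' (NConst 0) (NGet ''ptr'' (scalar ''a'')))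
    (Seq (NSet ''z'' (NConst 0) (NAdd (scalar ''n'') (scalar ''k'')))
    (Seq Merge
      (NSet ''ptr'' (scalar ''p'') (scalar ''z'')))))))"
  let ?F = "For ''k'' (NSub (scalar ''n'') (NConst 1)) ?C"
  show ?thesis unfolding Merges_def
  proof (rule runs_For[where I = "merged n E c ord ?par"])
    fix k s1 assume k: "k < n - 1" and I: "merged n E c ord ?par k s1" and k1: "nmem s1 ''k'' 0 = k"
      and f1: "frame ?F s s1"
    have r1: "ready n E c b s1"
      using f1 rdy by (rule ready_frame) (auto simp: input_nats_def input_reals_def)
    have e1: "nmem s1 ''par'' = ?par" "nmem s1 ''n'' 0 = n"
      using f1 rdy by (simp_all add: frame_def ready_def)
    obtain bk where bk: "blocks n ord ?par (n - k) bk"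
      and ptr: "\<And>i. i < n - k \<Longrightarrow> nmem s1 ''ptr'' i < n + k"
      and rep: "\<And>i. i < n - k \<Longrightarrow> represents ?B c (tbl n s1 (nmem s1 ''ptr'' i)) (candidates E (bk i) (ord i))"
      and empty: "\<And>z m q. n + k \<le> z \<Longrightarrow> m < ?B \<Longrightarrow> q < ?B \<Longrightarrow> tbl n s1 z m q = None"
      using I unfolding merged_def by blast
    define a where "a = n - Suc k"
    define p where "p = ?par a"
    have a: "0 < a" "a < n" "Suc a = n - k" using k by (auto simp: a_def)
    have p: "p < a" "{ord p, ord a} \<in> E" using so a by (auto simp: search_order_def p_def)
    note bk' = bk[folded a(3)]
    have pa: "p < n - k" "a < n - k" using p a by auto
    have root: "ord p \<in> bk p" "ord a \<in> bk a" using bk' p by (auto simp: blocks_def)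
    have dis: "bk p \<inter> bk a = {}" using bk' p by (auto simp: blocks_def)
    have sub: "bk p \<union> bk a \<subseteq> {..<n}" using bk' p unfolding blocks_def by fastforce
    have only: "u = ord p \<and> v = ord a" if "u \<in> bk p" "v \<in> bk a" "{u, v} \<in> E" for u v
      using blocks_edge[OF tree so bk' a(1,2), folded p_def] that by blast
    have fin: "finite (bk p)" "finite (bk a)" using sub by (auto intro: finite_subset)
    have join: "candidates E (bk p \<union> bk a) (ord p) =
      {combine P Q | P Q. P \<in> candidates E (bk p) (ord p) \<and> Q \<in> candidates E (bk a) (ord a)}"
      by (rule candidates_join[OF p(2) dis fin only root])
    define x y z where "x = nmem s1 ''ptr'' p" and "y = nmem s1 ''ptr'' a" and "z = n + k"
    have xyz: "x < z" "y < z" using ptr[OF pa(1)] ptr[OF pa(2)] by (simp_all add: x_def y_def z_def)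
    \<comment> \<open>Slot numbers must stay within the address tables; they do, as
      \<open>(n - 1)^2\<close> is nonnegative.\<close>
    have "2 * n \<le> Suc (n * n)" by (cases n rule: nat.exhaust; cases "n \<le> 1") auto
    then have zB: "z \<le> ?B" using k by (simp add: z_def base_def)
    have repx: "represents ?B c (tbl n s1 x) (candidates E (bk p) (ord p))"
      and repy: "represents ?B c (tbl n s1 y) (candidates E (bk a) (ord a))"
      using rep pa by (simp_all add: x_def y_def)
    have ok: "mergeable ?B c (tbl n s1 x) (tbl n s1 y)"
      by (rule mergeable_candidates[OF repx repy p(2) dis sub _ base_bounds(1) only root])
        (simp add: base_def)
    have repz: "represents ?B c (tbl n s1 z) {}"
      using empty by (simp add: represents_def z_def)
    let ?s2 = "nupd ''z'' 0 z (nupd ''y'' 0 y (nupd ''x'' 0 x (nupd ''p'' 0 p (nupd ''a'' 0 a s1))))"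
    have r2: "ready n E c b ?s2" using r1 by (simp add: input_nats_def)
    have t2: "tbl n ?s2 = tbl n s1" by simp
    have "runs ?B (Seq Merge (NSet ''ptr'' (scalar ''p'') (scalar ''z''))) ?s2
      (merged n E c ord ?par (Suc k))"
    proof (rule runs_Seq[OF runs_Merge[OF r2, of x y z]])
      fix s3 assume f3: "frame Merge ?s2 s3"
        and t3: "(\<forall>z' m q. z' \<noteq> z \<longrightarrow> m < ?B \<longrightarrow> q < ?B \<longrightarrow> tbl n s3 z' m q = tbl n ?s2 z' m q) \<and>
          represents ?B c (tbl n s3 z)
          (\<Union>p \<in> {..<?B} \<times> {..<?B} \<times> {..<?B} \<times> {..<?B}. combinations (tbl n ?s2 x) (tbl n ?s2 y) p)"
      have e3: "nmem s3 ''p'' 0 = p" "nmem s3 ''z'' 0 = z" "nmem s3 ''ptr'' = nmem s1 ''ptr''"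
        using f3 by (simp_all add: frame_def)
      have old: "tbl n s3 z' m q = tbl n s1 z' m q" if "z' \<noteq> z" "m < ?B" "q < ?B" for z' m q
        using t3 that by (simp add: t2)
      have "(\<Union>p \<in> {..<?B} \<times> {..<?B} \<times> {..<?B} \<times> {..<?B}. combinations (tbl n s1 x) (tbl n s1 y) p) =
        {combine (m1, q1, D1) (m2, q2, D2) | m1 q1 r1 D1 m2 q2 r2 D2.
          m1 < ?B \<and> q1 < ?B \<and> m2 < ?B \<and> q2 < ?B \<and>
          tbl n s1 x m1 q1 = Some (r1, D1) \<and> tbl n s1 y m2 q2 = Some (r2, D2)}"
        unfolding combinations_def by (auto simp del: combine.simps) blast+
      then have "represents ?B c (tbl n s3 z) {combine (m1, q1, D1) (m2, q2, D2) | m1 q1 r1 D1 m2 q2 r2 D2.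
          m1 < ?B \<and> q1 < ?B \<and> m2 < ?B \<and> q2 < ?B \<and>
          tbl n s1 x m1 q1 = Some (r1, D1) \<and> tbl n s1 y m2 q2 = Some (r2, D2)}"
        using t3 by (simp add: t2)
      then have new: "represents ?B c (tbl n s3 z) (candidates E (bk p \<union> bk a) (ord p))"
        unfolding join
        by (rule represents_combine[OF repx repy, where X = "bk p" and Y = "bk a"])
          (use dis fin in \<open>auto simp: candidates_def\<close>)
      let ?bk = "bk(p := bk p \<union> bk a)"
      let ?s4 = "nupd ''ptr'' p z s3"
      have nk: "n - Suc k = a" by (simp add: a_def)
      have t4: "tbl n ?s4 = tbl n s3" by simp
      have blk: "blocks n ord ?par a ?bk"
        using blocks_merge[OF so bk' a(1,2)] by (simp add: p_def)
      have all: "nmem ?s4 ''ptr'' i < n + Suc k \<and>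
          represents ?B c (tbl n ?s4 (nmem ?s4 ''ptr'' i)) (candidates E (?bk i) (ord i))" if i: "i < a" for i
      proof (cases "i = p")
        case True
        then show ?thesis using new by (simp add: z_def)
      next
        case False
        have ia: "i < n - k" using i a by simp
        have "represents ?B c (tbl n s3 (nmem s1 ''ptr'' i)) (candidates E (bk i) (ord i))"
          \<comment> \<open>All remaining blocks have slots below \<open>n + k\<close>, while this
            round writes to slot \<open>n + k\<close>.\<close>
          by (rule represents_cong[OF rep[OF ia]]) (use old ptr[OF ia] in \<open>simp add: z_def\<close>)
        then show ?thesis using False ptr[OF ia] by (simp add: e3)
      qed
      have emp: "tbl n ?s4 z' m q = None" if "n + Suc k \<le> z'" "m < ?B" "q < ?B" for z' m q
        unfolding t4 using old[of z' m q] empty[of z' m q] that by (simp add: z_def)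
      have "merged n E c ord ?par (Suc k) ?s4"
        unfolding merged_def nk using blk all emp by blast
      then show "runs ?B (NSet ''ptr'' (scalar ''p'') (scalar ''z'')) s3 (merged n E c ord ?par (Suc k))"
        by (intro runs_NSet) (simp add: e3)
    qed (use xyz zB ok repz t2 in \<open>simp_all del: tbl_nupd\<close>)
    then show "runs ?B ?C s1 (merged n E c ord ?par (Suc k))"
      by (intro runs_NSet_Seq)
        (simp add: e1 k1 a_def[symmetric] p_def[symmetric] x_def[symmetric] y_def[symmetric]
          z_def[symmetric])
  next
    fix s' assume "frame ?F s s'"
    then show "nval (NSub (scalar ''n'') (NConst 1)) s' = n - 1"
      using rdy by (simp add: frame_def ready_def)
  next
    show "n - 1 \<le> ?B" using base_bounds(2)[of n] by simp
  next
    fix k j s' assume "merged n E c ord ?par k s'"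
    then show "merged n E c ord ?par k (nupd ''k'' 0 j s')" by (simp add: merged_def)
  qed (use init in auto)
qed

section \<open>Reading off the best affordable entry\<close>

definition Select :: com where
  "Select =
    Seq (NSet ''bq'' (NConst 0) (scalar ''B''))
    (Seq (NSet ''x'' (NConst 0) (scalar ''ptr''))
      (For ''q'' (scalar ''B'') (For ''m'' (scalar ''B'')
        (Cond (BAnd (NLess (NConst 0) (NGet ''val'' (cellE (scalar ''x'') (scalar ''m'') (scalar ''q''))))
          (BAnd (BNot (RLess (RGet ''budget'' (NConst 0))
              (RGet ''cst'' (cellE (scalar ''x'') (scalar ''m'') (scalar ''q'')))))
            (NLess (scalar ''q'') (scalar ''bq''))))
        (Seq (NSet ''bq'' (NConst 0) (scalar ''q''))
          (For ''u'' (scalar ''n'') (NSet ''sol'' (scalar ''u'')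
            (NGet ''bit'' (bitE (scalar ''x'') (scalar ''m'') (scalar ''q'') (scalar ''u''))))))
        Skip))))"

text \<open>The initial value \<open>base n\<close> of \<open>bq\<close> exceeds every index and
  stands for no choice so far. The affordable entry assumed in \<open>ex\<close> ensures that it
  gets replaced.\<close>

lemma runs_Select:
  assumes rdy: "ready n E c b s" and x: "nmem s ''ptr'' 0 = x" "x \<le> base n"
    and ex: "m0 < base n" "q0 < base n" "tbl n s x m0 q0 = Some (r0, D0)" "r0 \<le> b"
  shows "runs (base n) Select s (\<lambda>s'. \<exists>m<base n. \<exists>q<base n. \<exists>r.
    tbl n s x m q = Some (r, {u. u < n \<and> nmem s' ''sol'' u \<noteq> 0}) \<and> r \<le> b \<and>
    (\<forall>m'<base n. \<forall>q'<base n. \<forall>r' D'. tbl n s x m' q' = Some (r', D') \<longrightarrow> r' \<le> b \<longrightarrow> q \<le> q'))"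
proof -
  let ?B = "base n" and ?s = "nupd ''x'' 0 x (nupd ''bq'' 0 (base n) s)"
  \<comment> \<open>The first half is the lower bound over the scanned entries; the second says that
    \<open>sol\<close> holds the set of an affordable entry attaining \<open>bq\<close>.\<close>
  let ?J = "\<lambda>P s'. (\<forall>m q r D. (q, m) \<in> P \<longrightarrow> tbl n s x m q = Some (r, D) \<longrightarrow> r \<le> b \<longrightarrow>
      nmem s' ''bq'' 0 \<le> q) \<and>
    (nmem s' ''bq'' 0 < ?B \<longrightarrow> (\<exists>m<?B. \<exists>r.
      tbl n s x m (nmem s' ''bq'' 0) = Some (r, {u. u < n \<and> nmem s' ''sol'' u \<noteq> 0}) \<and> r \<le> b))"
  let ?t = "BAnd (NLess (NConst 0) (NGet ''val'' (cellE (scalar ''x'') (scalar ''m'') (scalar ''q''))))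
          (BAnd (BNot (RLess (RGet ''budget'' (NConst 0))
              (RGet ''cst'' (cellE (scalar ''x'') (scalar ''m'') (scalar ''q'')))))
            (NLess (scalar ''q'') (scalar ''bq'')))"
  let ?W = "NSet ''sol'' (scalar ''u'')
            (NGet ''bit'' (bitE (scalar ''x'') (scalar ''m'') (scalar ''q'') (scalar ''u'')))"
  let ?U = "For ''u'' (scalar ''n'') ?W"
  let ?C = "Cond ?t (Seq (NSet ''bq'' (NConst 0) (scalar ''q'')) ?U) Skip"
  let ?F2 = "For ''m'' (scalar ''B'') ?C"
  let ?F1 = "For ''q'' (scalar ''B'') ?F2"
  have rdy': "ready n E c b ?s" using rdy by (simp add: input_nats_def)
  have nB: "nval (scalar ''B'') s' = ?B" if "frame ?F1 ?s s'" for s'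
    using that rdy' by (simp add: frame_def ready_def)
  have inner: "runs ?B ?C s' (?J (P \<union> {(q, m)}))"
    if J: "?J P s'" and fr: "frame ?F1 ?s s'"
      and v: "nmem s' ''q'' 0 = q" "nmem s' ''m'' 0 = m" "q < ?B" "m < ?B" for P s' q m
  proof -
    have r': "ready n E c b s'"
      using fr rdy' by (rule ready_frame) (auto simp: input_nats_def input_reals_def)
    have x': "nmem s' ''x'' 0 = x" using fr by (simp add: frame_def)
    have same: "nmem s' ''bit'' = nmem s ''bit''" "nmem s' ''val'' = nmem s ''val''"
      "rmem s' ''cst'' = rmem s ''cst''"
      using fr by (simp_all add: frame_def)
    let ?c = "cell n x m q"
    let ?D = "{u. u < n \<and> nmem s ''bit'' (?c * ?B + u) \<noteq> 0}" and ?r = "rmem s ''cst'' ?c"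
    have cl: "nval (cellE (scalar ''x'') (scalar ''m'') (scalar ''q'')) s' = ?c"
      using nval_cellE[OF r', of "scalar ''x''" "scalar ''m''"] v x' x by simp
    have test: "bval ?t s' \<longleftrightarrow> tbl n s x m q = Some (?r, ?D) \<and> ?r \<le> b \<and> q < nmem s' ''bq'' 0"
      using r' by (auto simp: cl same v tbl_def ready_def)
    show ?thesis
    proof (rule runs_Cond; simp only: test)
      assume t: "tbl n s x m q = Some (?r, ?D) \<and> ?r \<le> b \<and> q < nmem s' ''bq'' 0"
      let ?s1 = "nupd ''bq'' 0 q s'"
      have U: "runs ?B ?U ?s1 (\<lambda>s''. \<forall>u<n. nmem s'' ''sol'' u = nmem s ''bit'' (?c * ?B + u))"
      proof (rule runs_For[where I = "\<lambda>i s''. \<forall>u<i. nmem s'' ''sol'' u = nmem s ''bit'' (?c * ?B + u)"])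
        fix i s2 assume I: "\<forall>u<i. nmem s2 ''sol'' u = nmem s ''bit'' (?c * ?B + u)"
          and u: "nmem s2 ''u'' 0 = i" and f: "frame ?U ?s1 s2"
        have "ready n E c b ?s1" using r' by (simp add: input_nats_def)
        with f have r2: "ready n E c b s2"
          by (rule ready_frame) (auto simp: input_nats_def input_reals_def)
        have e: "nmem s2 ''x'' 0 = x" "nmem s2 ''m'' 0 = m" "nmem s2 ''q'' 0 = q"
          "nmem s2 ''bit'' = nmem s ''bit''"
          using f x' v same by (simp_all add: frame_def)
        have "nval (bitE (scalar ''x'') (scalar ''m'') (scalar ''q'') (scalar ''u'')) s2 = ?c * ?B + i"
          using nval_bitE[OF r2, of "scalar ''x''" "scalar ''m''" "scalar ''q''" "scalar ''u''"] e v u x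
          by simp
        then show "runs ?B ?W s2 (\<lambda>s''. \<forall>u<Suc i. nmem s'' ''sol'' u = nmem s ''bit'' (?c * ?B + u))"
          using I by (intro runs_NSet) (simp add: e u less_Suc_eq)
      next
        fix s2 assume "frame ?U ?s1 s2"
        then show "nval (scalar ''n'') s2 = n" using r' by (simp add: frame_def ready_def)
      qed (simp_all add: base_bounds)
      have "runs ?B ?U ?s1 (?J (P \<union> {(q, m)}))"
      proof (rule runs_conseq[OF U])
        fix s2 assume f: "frame ?U ?s1 s2"
          and sol: "\<forall>u<n. nmem s2 ''sol'' u = nmem s ''bit'' (?c * ?B + u)"
        have bq: "nmem s2 ''bq'' 0 = q" using f by (simp add: frame_def)
        have D: "{u. u < n \<and> nmem s2 ''sol'' u \<noteq> 0} = ?D" using sol by auto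
        have "q \<le> q'" if "(q', m') \<in> P \<union> {(q, m)}" "tbl n s x m' q' = Some (r, D)" "r \<le> b" for q' m' r D
        proof (cases "(q', m') \<in> P")
          case True
          then have "nmem s' ''bq'' 0 \<le> q'" using J that by blast
          then show ?thesis using t by simp
        qed (use that in auto)
        then show "?J (P \<union> {(q, m)}) s2"
          unfolding bq D using t v by blast
      qed
      then show "runs ?B (Seq (NSet ''bq'' (NConst 0) (scalar ''q'')) ?U) s' (?J (P \<union> {(q, m)}))"
        by (intro runs_NSet_Seq) (simp only: nval.simps v)
    next
      assume t: "\<not> (tbl n s x m q = Some (?r, ?D) \<and> ?r \<le> b \<and> q < nmem s' ''bq'' 0)"
      have "nmem s' ''bq'' 0 \<le> q" if "tbl n s x m q = Some (r, D)" "r \<le> b" for r D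
        using t that by (auto simp: tbl_def split: if_splits)
      then show "runs ?B Skip s' (?J (P \<union> {(q, m)}))"
        using J by (intro runs_Skip) blast
    qed
  qed
  have "runs ?B ?F1 ?s (?J ({} \<union> (\<Union>q<?B. \<Union>m<?B. {(q, m)})))"
  proof (rule runs_For_union[where J = ?J])
    fix q P s1 assume q: "q < ?B" "nmem s1 ''q'' 0 = q" and J1: "?J P s1" and f1: "frame ?F1 ?s s1"
    have g: "frame ?F1 ?s s'" if "frame ?F2 s1 s'" for s'
      using frame_trans[OF f1 frame_sub[OF that]] by auto
    show "runs ?B ?F2 s1 (?J (P \<union> (\<Union>m<?B. {(q, m)})))"
    proof (rule runs_For_union[where J = ?J])
      fix m P' s2 assume m: "m < ?B" "nmem s2 ''m'' 0 = m" and J2: "?J P' s2" and f2: "frame ?F2 s1 s2"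
      have "nmem s2 ''q'' 0 = q" using f2 q by (simp add: frame_def)
      from inner[OF J2 g[OF f2] this m(2) q(1) m(1)]
      show "runs ?B ?C s2 (?J (P' \<union> {(q, m)}))" .
    next
      fix s' assume "frame ?F2 s1 s'"
      then show "nval (scalar ''B'') s' = ?B" using nB[OF g] by blast
    qed (use J1 in auto)
  qed (use nB in auto)
  then have "runs ?B Select s (?J ({} \<union> (\<Union>q<?B. \<Union>m<?B. {(q, m)})))"
    unfolding Select_def using rdy x by (intro runs_NSet_Seq) (simp add: ready_def)
  then show ?thesis
  proof (rule runs_conseq)
    fix s' assume J: "?J ({} \<union> (\<Union>q<?B. \<Union>m<?B. {(q, m)})) s'"
    have mem: "(q, m) \<in> {} \<union> (\<Union>q<?B. \<Union>m<?B. {(q, m)})" if "q < ?B" "m < ?B" for q m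
      using that by auto
    have le: "nmem s' ''bq'' 0 \<le> q" if "m < ?B" "q < ?B" "tbl n s x m q = Some (r, D)" "r \<le> b" for m q r D
      using J mem[OF that(2,1)] that(3,4) by blast
    have bq: "nmem s' ''bq'' 0 < ?B" using le[OF ex] ex(2) by simp
    then obtain m r where "m < ?B"
      "tbl n s x m (nmem s' ''bq'' 0) = Some (r, {u. u < n \<and> nmem s' ''sol'' u \<noteq> 0})" "r \<le> b"
      using J by blast
    then show "\<exists>m<?B. \<exists>q<?B. \<exists>r.
      tbl n s x m q = Some (r, {u. u < n \<and> nmem s' ''sol'' u \<noteq> 0}) \<and> r \<le> b \<and>
      (\<forall>m'<?B. \<forall>q'<?B. \<forall>r' D'. tbl n s x m' q' = Some (r', D') \<longrightarrow> r' \<le> b \<longrightarrow> q \<le> q')"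
      using bq le by blast
  qed
qed

section \<open>Correctness of the whole program\<close>

definition Program :: com where
  "Program = Seq Powers (Seq Order (Seq Init (Seq Merges Select)))"

text \<open>In a tree \<open>GBC\<close> is a constant minus the number of linked pairs.\<close>

lemma optimal_if_least_linked:
  assumes tree: "is_tree (nodes I) (edges I)" and feas: "mbc_feasible I C"
    and least: "\<And>D. mbc_feasible I D \<Longrightarrow>
      card (linked_pairs (edges I) (nodes I - C)) \<le> card (linked_pairs (edges I) (nodes I - D))"
  shows "mbc_optimal I C"
  using feas least by (simp add: mbc_optimal_def GBC_tree[OF tree])

lemma runs_Program:
  assumes I: "mbc_instance I" and tree: "is_tree (nodes I) (edges I)" and nodes: "nodes I = {..<n}"
  shows "runs (base n) Program (mbc_encode I) (\<lambda>s. mbc_optimal I (mbc_decode I s))"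
proof -
  let ?B = "base n" and ?E = "edges I" and ?c = "cost I" and ?b = "budget I"
  let ?e = "mbc_encode I"
  have cn: "card (nodes I) = n" by (simp add: nodes)
  have tree': "is_tree {..<n} ?E" using tree by (simp add: nodes)
  have conn: "connected_graph {..<n} ?E" using tree' by (simp add: is_tree_def)
  then have n: "0 < n" by (auto simp: connected_graph_def)
  have nz: "nmem ?e x i = 0" if "x \<noteq> ''n''" "x \<noteq> ''adj''" for x i
    using that by (simp add: mbc_encode_def Let_def)
  have adj: "nmem ?e ''adj'' (u * n + v) \<noteq> 0 \<longleftrightarrow> {u, v} \<in> ?E" if "u < n" "v < n" for u v
  proof -
    \<comment> \<open>The address must lie inside the encoded matrix; then \<open>div\<close> and
      \<open>mod\<close> recover \<open>u\<close> and \<open>v\<close>.\<close>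
    have "u * n + v < Suc u * n" using that by simp
    also have "\<dots> \<le> n * n" using that by (intro mult_right_mono) auto
    finally show ?thesis using that by (simp add: mbc_encode_def Let_def cn)
  qed
  have P: "runs ?B Powers ?e (ready n ?E ?c ?b)"
    by (rule runs_Powers) (use adj in \<open>auto simp: mbc_encode_def Let_def cn\<close>)
  show ?thesis unfolding Program_def
  proof (rule runs_Seq[OF P])
    fix s1 assume f1: "frame Powers ?e s1" and r1: "ready n ?E ?c ?b s1"
    have z1: "nmem s1 ''ord'' i = 0" "nmem s1 ''vis'' i = 0" "nmem s1 ''val'' i = 0" for i
      using f1 nz by (simp_all add: frame_def)
    show "runs ?B (Seq Order (Seq Init (Seq Merges Select))) s1 (\<lambda>s. mbc_optimal I (mbc_decode I s))"
    proof (rule runs_Seq[OF runs_Order[OF r1 n conn z1(1,2)]])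
      fix s2 assume f2: "frame Order s1 s2" and so: "search_order ?E n (nmem s2 ''ord'') (nmem s2 ''par'') n"
      have r2: "ready n ?E ?c ?b s2"
        using f2 r1 by (rule ready_frame) (auto simp: input_nats_def input_reals_def)
      let ?ord = "nmem s2 ''ord''" and ?par = "nmem s2 ''par''"
      have ord: "?ord i < n" if "i < n" for i
        using so that by (auto simp: search_order_def image_subset_iff)
      have empty: "tbl n s2 z m q = None" for z m q
        using z1(3) f2 by (simp add: frame_def tbl_def)
      show "runs ?B (Seq Init (Seq Merges Select)) s2 (\<lambda>s. mbc_optimal I (mbc_decode I s))"
      proof (rule runs_Seq[OF runs_Init[OF r2 ord empty]], assumption)
        fix s3 assume f3: "frame Init s2 s3"
          and i3: "(\<forall>i<n. nmem s3 ''ptr'' i = i \<and> represents ?B ?c (tbl n s3 i)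
              (candidates ?E {?ord i} (?ord i))) \<and>
            (\<forall>z\<ge>n. \<forall>m<?B. \<forall>q<?B. tbl n s3 z m q = None)"
        have r3: "ready n ?E ?c ?b s3"
          using f3 r2 by (rule ready_frame) (auto simp: input_nats_def input_reals_def)
        have par3: "nmem s3 ''par'' = ?par" using f3 by (simp add: frame_def)
        have "blocks n ?ord ?par n (\<lambda>i. {?ord i})" by (rule blocks_init[OF so])
        then have m3: "merged n ?E ?c ?ord (nmem s3 ''par'') 0 s3"
          unfolding merged_def par3 using i3 by (intro conjI exI[of _ "\<lambda>i. {?ord i}"]) auto
        show "runs ?B (Seq Merges Select) s3 (\<lambda>s. mbc_optimal I (mbc_decode I s))"
        proof (rule runs_Seq[OF runs_Merges[OF r3 tree' so[folded par3] m3]])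
          fix s4 assume f4: "frame Merges s3 s4"
            and m4: "merged n ?E ?c ?ord (nmem s3 ''par'') (n - 1) s4"
          have r4: "ready n ?E ?c ?b s4"
            using f4 r3 by (rule ready_frame) (auto simp: input_nats_def input_reals_def)
          have n1: "n - (n - 1) = 1" using n by simp
          define x where "x = nmem s4 ''ptr'' 0"
          obtain bk where bk: "blocks n ?ord ?par 1 bk" and x: "x < n + (n - 1)"
            and rep: "represents ?B ?c (tbl n s4 x) (candidates ?E (bk 0) (?ord 0))"
            using m4 unfolding merged_def n1 par3 x_def by auto
          have "bk 0 = {..<n}" using bk by (simp add: blocks_def lessThan_Suc)
          then have rep: "represents ?B ?c (tbl n s4 x) (candidates ?E {..<n} (?ord 0))"
            using rep by simp
          have "2 * n \<le> Suc (n * n)" by (cases n rule: nat.exhaust; cases "n \<le> 1") auto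
          then have xB: "x \<le> ?B" using x by (simp add: base_def)
          have cand: "(card (component ?E ({..<n} - D) (?ord 0)), card (linked_pairs ?E ({..<n} - D)), D)
            \<in> candidates ?E {..<n} (?ord 0)" if "D \<subseteq> {..<n}" for D
            using that by (auto simp: candidates_def)
          \<comment> \<open>The empty set costs 0 and the budget is nonnegative, so some entry is
            affordable.\<close>
          obtain r0 D0 where
            "card (component ?E ({..<n} - {}) (?ord 0)) < ?B" "card (linked_pairs ?E ({..<n} - {})) < ?B"
            "tbl n s4 x (card (component ?E ({..<n} - {}) (?ord 0)))
              (card (linked_pairs ?E ({..<n} - {}))) = Some (r0, D0)" "r0 \<le> sum ?c {}"
            by (rule represents_complete[OF rep cand[of "{}"]]) auto
          moreover from this have "r0 \<le> ?b" using I by (simp add: mbc_instance_def)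
          ultimately have "runs ?B Select s4 (\<lambda>s'. \<exists>m<?B. \<exists>q<?B. \<exists>r.
            tbl n s4 x m q = Some (r, {u. u < n \<and> nmem s' ''sol'' u \<noteq> 0}) \<and> r \<le> ?b \<and>
            (\<forall>m'<?B. \<forall>q'<?B. \<forall>r' D'. tbl n s4 x m' q' = Some (r', D') \<longrightarrow> r' \<le> ?b \<longrightarrow> q \<le> q'))"
            by (intro runs_Select[OF r4 x_def[symmetric] xB])
          then show "runs ?B Select s4 (\<lambda>s. mbc_optimal I (mbc_decode I s))"
          proof (rule runs_conseq)
            fix s5 :: store assume "\<exists>m<?B. \<exists>q<?B. \<exists>r.
              tbl n s4 x m q = Some (r, {u. u < n \<and> nmem s5 ''sol'' u \<noteq> 0}) \<and> r \<le> ?b \<and>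
              (\<forall>m'<?B. \<forall>q'<?B. \<forall>r' D'. tbl n s4 x m' q' = Some (r', D') \<longrightarrow> r' \<le> ?b \<longrightarrow> q \<le> q')"
            then obtain m q r where mq: "m < ?B" "q < ?B"
              and t: "tbl n s4 x m q = Some (r, mbc_decode I s5)" and r: "r \<le> ?b"
              and least: "\<And>m' q' r' D'. m' < ?B \<Longrightarrow> q' < ?B \<Longrightarrow>
                tbl n s4 x m' q' = Some (r', D') \<Longrightarrow> r' \<le> ?b \<Longrightarrow> q \<le> q'"
              unfolding mbc_decode_def nodes lessThan_iff by blast
            have q: "q = card (linked_pairs ?E ({..<n} - mbc_decode I s5))"
              and sub: "mbc_decode I s5 \<subseteq> {..<n}" and rs: "r = sum ?c (mbc_decode I s5)"
              using represents_sound[OF rep mq t] by (auto simp: candidates_def)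
            show "mbc_optimal I (mbc_decode I s5)"
            proof (rule optimal_if_least_linked[OF tree])
              show "mbc_feasible I (mbc_decode I s5)"
                using sub rs r by (simp add: mbc_feasible_def nodes)
            next
              fix D assume "mbc_feasible I D"
              then have D: "D \<subseteq> {..<n}" "sum ?c D \<le> ?b" by (auto simp: mbc_feasible_def nodes)
              \<comment> \<open>The entry at the index of \<open>D\<close> costs no more than
                \<open>D\<close> itself, so it is affordable and \<open>q\<close> was compared with
                it.\<close>
              from rep cand[OF D(1)] have "q \<le> card (linked_pairs ?E ({..<n} - D))"
                by (rule represents_complete) (use least D(2) in force)
              then show "card (linked_pairs ?E (nodes I - mbc_decode I s5))
                \<le> card (linked_pairs ?E (nodes I - D))"
                by (simp add: q nodes)
            qed
          qed
        qed
      qed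
    qed
  qed
qed

theorem theorem4:
  shows "polytime_solvable
    {I. mbc_instance I \<and> is_tree (nodes I) (edges I) \<and> numbered I}
    mbc_size
    mbc_encode
    (\<lambda>I s. mbc_optimal I (mbc_decode I s))"
  unfolding polytime_solvable_def
proof (rule exI, rule exI, rule ballI)
  fix I :: "nat mbc"
  assume "I \<in> {I. mbc_instance I \<and> is_tree (nodes I) (edges I) \<and> numbered I}"
  then obtain n where I: "mbc_instance I" "is_tree (nodes I) (edges I)" and nodes: "nodes I = {..<n}"
    by (auto simp: numbered_def)
  \<comment> \<open>The loop bound \<open>base n\<close> is itself the polynomial
    \<open>1 + n^2\<close> in the input size, so composing it with \<open>steps\<close> bounds the
    running time.\<close>
  have "poly [:1, 0, 1:] (mbc_size I) = base n"
    by (simp add: mbc_size_def nodes base_def)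
  then show "\<exists>t s'. exec Program (mbc_encode I) t s' \<and>
      t \<le> poly (pcompose (steps Program) [:1, 0, 1:]) (mbc_size I) \<and> mbc_optimal I (mbc_decode I s')"
    using runs_Program[OF I nodes] by (simp add: runs_def poly_pcompose)
qed

end
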